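(* Let $i\in\mathbb S^2$. Then $f\in\mathcal B_i$ if and only if $f\in\mathcal B$. The space $(\mathcal B,\|\cdot\|_{\mathcal B})$ is a Banach space, and $(\mathcal B,\|\cdot\|_{\mathcal B})$ and $(\mathcal B_i,\|\cdot\|_{\mathcal B_i})$ have equivalent norms. Precisely, one has $$\|f\|_{\mathcal B_i}\le\|f\|_{\mathcal B}\le 2\|f\|_{\mathcal B_i}.$$
   Context: $\mathbb H$ denotes the quaternions, $q=x_0+x_1e_1+x_2e_2+x_3e_3$, and $\mathbb S^2$ the sphere of purely imaginary unit quaternions. For $i\in\mathbb S^2$, $\mathbb C(i)=\{x+iy: x,y\in\mathbb R\}$ (isomorphic to the complex field). $\mathbb B$ is the open unit ball of $\mathbb H$ centered at $0$ and $\mathbb B_i=\mathbb B\cap\mathbb C(i)$. A real differentiable function $f:\mathbb B\to\mathbb H$ is (left) slice regular if for every $i\in\mathbb S^2$, $\left(\frac{\partial}{\partial x}+i\frac{\partial}{\partial y}\right)f(x+iy)=0$ on $\mathbb B_i$; $\mathcal{SR}(\mathbb B)$ is the set of these functions. $Q_i[f]=f|_{\mathbb B_i}$, and $Q_i[f]'(z)=\frac{\partial Q_i[f]}{\partial x_0}(z)$. $\mathcal B$ is the quaternionic right linear space of $f\in\mathcal{SR}(\mathbb B)$ with $\sup_{q\in\mathbb B}(1-|q|^2)\left|\frac{\partial f}{\partial x_0}(q)\right|<\infty$, with norm $\|f\|_{\mathcal B}=|f(0)|+\sup_{q\in\mathbb B}(1-|q|^2)\left|\frac{\partial f}{\partial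 x_0}(q)\right|$. $\mathcal B_i$ is the quaternionic right linear space of $f\in\mathcal{SR}(\mathbb B)$ with $\sup_{z\in\mathbb B_i}(1-|z|^2)|Q_i[f]'(z)|<\infty$, with norm $\|f\|_{\mathcal B_i}=|f(0)|+\sup_{z\in\mathbb B_i}(1-|z|^2)|Q_i[f]'(z)|$. *)

theory Defs
  imports "HOL-Analysis.Analysis" "HOL-Library.Function_Algebras"
begin

section \<open>Quaternions\<close>

codatatype quat = Quat (qx0: real) (qx1: real) (qx2: real) (qx3: real)

lemma quat_eq_iff:
  "p = q \<longleftrightarrow> qx0 p = qx0 q \<and> qx1 p = qx1 q \<and> qx2 p = qx2 q \<and> qx3 p = qx3 q"
  by (auto intro: quat.expand)

lemma quat_eqI:
  "qx0 p = qx0 q \<Longrightarrow> qx1 p = qx1 q \<Longrightarrow> qx2 p = qx2 q \<Longrightarrow> qx3 p = qx3 q \<Longrightarrow> p = q"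
  by (simp add: quat_eq_iff)

instantiation quat :: ab_group_add
begin

primcorec zero_quat where
  "qx0 0 = 0" | "qx1 0 = 0" | "qx2 0 = 0" | "qx3 0 = 0"

primcorec plus_quat where
  "qx0 (p + q) = qx0 p + qx0 q"
| "qx1 (p + q) = qx1 p + qx1 q"
| "qx2 (p + q) = qx2 p + qx2 q"
| "qx3 (p + q) = qx3 p + qx3 q"

primcorec uminus_quat where
  "qx0 (- p) = - qx0 p"
| "qx1 (- p) = - qx1 p"
| "qx2 (- p) = - qx2 p"
| "qx3 (- p) = - qx3 p"

primcorec minus_quat where
  "qx0 (p - q) = qx0 p - qx0 q"
| "qx1 (p - q) = qx1 p - qx1 q"
| "qx2 (p - q) = qx2 p - qx2 q"
| "qx3 (p - q) = qx3 p - qx3 q"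

instance
  by standard (simp_all add: quat_eq_iff)

end

text \<open>Hamilton's multiplication: \<open>e1\<^sup>2 = e2\<^sup>2 = e3\<^sup>2 = -1\<close>, \<open>e1 e2 = e3 = - e2 e1\<close>, and cyclically.\<close>

instantiation quat :: ring_1
begin

primcorec one_quat where
  "qx0 1 = 1" | "qx1 1 = 0" | "qx2 1 = 0" | "qx3 1 = 0"

primcorec times_quat where
  "qx0 (p * q) = qx0 p * qx0 q - qx1 p * qx1 q - qx2 p * qx2 q - qx3 p * qx3 q"
| "qx1 (p * q) = qx0 p * qx1 q + qx1 p * qx0 q + qx2 p * qx3 q - qx3 p * qx2 q"
| "qx2 (p * q) = qx0 p * qx2 q - qx1 p * qx3 q + qx2 p * qx0 q + qx3 p * qx1 q"
| "qx3 (p * q) = qx0 p * qx3 q + qx1 p * qx2 q - qx2 p * qx1 q + qx3 p * qx0 q"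

instance
  by standard (simp_all add: quat_eq_iff distrib_left distrib_right left_diff_distrib right_diff_distrib)

end

instantiation quat :: real_algebra_1
begin

primcorec scaleR_quat where
  "qx0 (r *\<^sub>R q) = r * qx0 q"
| "qx1 (r *\<^sub>R q) = r * qx1 q"
| "qx2 (r *\<^sub>R q) = r * qx2 q"
| "qx3 (r *\<^sub>R q) = r * qx3 q"

instance
  by standard (simp_all add: quat_eq_iff distrib_left distrib_right left_diff_distrib right_diff_distrib)

end

instantiation quat :: real_div_algebra
begin

primcorec inverse_quat where
  "qx0 (inverse q) = qx0 q / ((qx0 q)\<^sup>2 + (qx1 q)\<^sup>2 + (qx2 q)\<^sup>2 + (qx3 q)\<^sup>2)"
| "qx1 (inverse q) = - qx1 q / ((qx0 q)\<^sup>2 + (qx1 q)\<^sup>2 + (qx2 q)\<^sup>2 + (qx3 q)\<^sup>2)"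
| "qx2 (inverse q) = - qx2 q / ((qx0 q)\<^sup>2 + (qx1 q)\<^sup>2 + (qx2 q)\<^sup>2 + (qx3 q)\<^sup>2)"
| "qx3 (inverse q) = - qx3 q / ((qx0 q)\<^sup>2 + (qx1 q)\<^sup>2 + (qx2 q)\<^sup>2 + (qx3 q)\<^sup>2)"

definition "p div q = p * inverse q" for p q :: quat

instance
proof
  fix p q :: quat
  show "p div q = p * inverse q"
    by (simp add: divide_quat_def)
  show "inverse (0 :: quat) = 0"
    by (simp add: quat_eq_iff)
  assume "p \<noteq> 0"
  define n where "n = (qx0 p)\<^sup>2 + (qx1 p)\<^sup>2 + (qx2 p)\<^sup>2 + (qx3 p)\<^sup>2"
  define c where "c = Quat (qx0 p) (- qx1 p) (- qx2 p) (- qx3 p)"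
  have "n \<noteq> 0"
    using \<open>p \<noteq> 0\<close> by (simp add: n_def quat_eq_iff add_nonneg_eq_0_iff)
  have inv: "inverse p = inverse n *\<^sub>R c"
    by (simp add: quat_eq_iff n_def c_def divide_inverse mult.commute)
  have "c * p = n *\<^sub>R 1" "p * c = n *\<^sub>R 1"
    by (simp_all add: quat_eq_iff n_def c_def power2_eq_square)
  with \<open>n \<noteq> 0\<close> show "inverse p * p = 1" "p * inverse p = 1"
    by (simp_all add: inv)
qed

end

instantiation quat :: real_normed_div_algebra
begin

definition "norm q = sqrt ((qx0 q)\<^sup>2 + (qx1 q)\<^sup>2 + (qx2 q)\<^sup>2 + (qx3 q)\<^sup>2)" for q :: quat

definition "sgn q = q /\<^sub>R norm q" for q :: quat

definition "dist p q = norm (p - q)" for p q :: quat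

definition [code del]:
  "(uniformity :: (quat \<times> quat) filter) = (INF e\<in>{0 <..}. principal {(p, q). dist p q < e})"

definition [code del]:
  "open (U :: quat set) \<longleftrightarrow> (\<forall>p\<in>U. eventually (\<lambda>(p', q). p' = p \<longrightarrow> q \<in> U) uniformity)"

instance
proof
  fix r :: real and p q :: quat and S :: "quat set"
  show "(norm p = 0) = (p = 0)"
    by (simp add: norm_quat_def quat_eq_iff add_nonneg_eq_0_iff)
  have n: "norm p = norm ((qx0 p, qx1 p), (qx2 p, qx3 p))" for p :: quat
    by (simp add: norm_quat_def norm_Pair add.assoc)
  show "norm (p + q) \<le> norm p + norm q"
    using norm_triangle_ineq[of "((qx0 p, qx1 p), (qx2 p, qx3 p))" "((qx0 q, qx1 q), (qx2 q, qx3 q))"]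
    by (simp add: n)
  show "norm (r *\<^sub>R p) = \<bar>r\<bar> * norm p"
    by (simp add: norm_quat_def power_mult_distrib distrib_left [symmetric] real_sqrt_mult)
  show "norm (p * q) = norm p * norm q"
  proof -
    have "(a*x - b*y - c*z - d*w)\<^sup>2 + (a*y + b*x + c*w - d*z)\<^sup>2 +
        (a*z - b*w + c*x + d*y)\<^sup>2 + (a*w + b*z - c*y + d*x)\<^sup>2 =
        (a\<^sup>2 + b\<^sup>2 + c\<^sup>2 + d\<^sup>2) * (x\<^sup>2 + y\<^sup>2 + z\<^sup>2 + w\<^sup>2)" for a b c d x y z w :: real
      by algebra
    then show ?thesis
      by (simp only: norm_quat_def times_quat.sel real_sqrt_mult [symmetric])
  qed
qed (rule sgn_quat_def dist_quat_def open_quat_def uniformity_quat_def)+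

end

instantiation quat :: real_inner
begin

definition "inner p q = qx0 p * qx0 q + qx1 p * qx1 q + qx2 p * qx2 q + qx3 p * qx3 q" for p q :: quat

instance
proof
  fix p q s :: quat and r :: real
  show "inner p q = inner q p"
    by (simp add: inner_quat_def mult.commute)
  show "inner (p + q) s = inner p s + inner q s"
    by (simp add: inner_quat_def distrib_right)
  show "inner (r *\<^sub>R p) q = r * inner p q"
    by (simp add: inner_quat_def distrib_left)
  show "0 \<le> inner p p"
    by (simp add: inner_quat_def)
  show "inner p p = 0 \<longleftrightarrow> p = 0"
    by (simp add: inner_quat_def quat_eq_iff add_nonneg_eq_0_iff)
  show "norm p = sqrt (inner p p)"
    by (simp add: inner_quat_def norm_quat_def power2_eq_square)
qed

end

instantiation quat :: euclidean_space
begin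

definition "Basis = {Quat 1 0 0 0, Quat 0 1 0 0, Quat 0 0 1 0, Quat 0 0 0 1}"

instance
proof
  fix u v x :: quat
  show "(Basis :: quat set) \<noteq> {}" "finite (Basis :: quat set)"
    by (simp_all add: Basis_quat_def)
  show "(\<forall>u\<in>Basis. inner x u = 0) \<longleftrightarrow> x = 0"
    by (simp add: Basis_quat_def inner_quat_def quat_eq_iff[of x])
  assume "u \<in> Basis" "v \<in> Basis"
  then show "inner u v = (if u = v then 1 else 0)"
    unfolding Basis_quat_def inner_quat_def by (elim insertE emptyE) simp_all
qed

end

section \<open>Slices and slice regular functions\<close>

definition imag_unit_sphere :: "quat set" where
  "imag_unit_sphere = {q. qx0 q = 0 \<and> norm q = 1}"

definition slice_plane :: "quat \<Rightarrow> quat set" where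
  "slice_plane i = {of_real x + i * of_real y | x y. True}"

definition unit_ball :: "quat set" where
  "unit_ball = ball 0 1"

definition slice_ball :: "quat \<Rightarrow> quat set" where
  "slice_ball i = unit_ball \<inter> slice_plane i"

definition partial_x0 :: "(quat \<Rightarrow> quat) \<Rightarrow> quat \<Rightarrow> quat" where
  "partial_x0 f q = vector_derivative (\<lambda>t. f (q + of_real t)) (at 0)"

definition slice_regular :: "(quat \<Rightarrow> quat) \<Rightarrow> bool" where
  "slice_regular f \<longleftrightarrow>
     f differentiable_on unit_ball \<and>
     (\<forall>i\<in>imag_unit_sphere. \<forall>x y. of_real x + i * of_real y \<in> slice_ball i \<longrightarrow>
        vector_derivative (\<lambda>s. f (of_real s + i * of_real y)) (at x)
        + i * vector_derivative (\<lambda>t. f (of_real x + i * of_real t)) (at y) = 0)"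

text \<open>
  A function on the unit ball is represented by its extension by zero to all quaternions. This
  makes the representative unique, so that the norms below can be definite, and it is compatible
  with the pointwise operations.
\<close>

definition slice_regular_functions :: "(quat \<Rightarrow> quat) set" where
  "slice_regular_functions = {f. slice_regular f \<and> (\<forall>q. q \<notin> unit_ball \<longrightarrow> f q = 0)}"

definition slice_restriction :: "quat \<Rightarrow> (quat \<Rightarrow> quat) \<Rightarrow> quat \<Rightarrow> quat" where
  "slice_restriction i f = restrict f (slice_ball i)"

section \<open>Bloch spaces\<close>

definition bloch :: "(quat \<Rightarrow> quat) set" where
  "bloch = {f \<in> slice_regular_functions.
     bdd_above ((\<lambda>q. (1 - (norm q)\<^sup>2) * norm (partial_x0 f q)) ` unit_ball)}"

definition bloch_norm :: "(quat \<Rightarrow> quat) \<Rightarrow> real" where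
  "bloch_norm f = norm (f 0) + (SUP q\<in>unit_ball. (1 - (norm q)\<^sup>2) * norm (partial_x0 f q))"

definition slice_bloch :: "quat \<Rightarrow> (quat \<Rightarrow> quat) set" where
  "slice_bloch i = {f \<in> slice_regular_functions.
     bdd_above ((\<lambda>z. (1 - (norm z)\<^sup>2) * norm (partial_x0 (slice_restriction i f) z)) ` slice_ball i)}"

definition slice_bloch_norm :: "quat \<Rightarrow> (quat \<Rightarrow> quat) \<Rightarrow> real" where
  "slice_bloch_norm i f =
     norm (f 0) + (SUP z\<in>slice_ball i. (1 - (norm z)\<^sup>2) * norm (partial_x0 (slice_restriction i f) z))"

section \<open>Normed right quaternionic linear spaces\<close>

text \<open>
  The space is a carrier \<open>V\<close> inside an abelian group, and the axioms are only required on \<open>V\<close>.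
\<close>

locale quat_right_normed_space =
  fixes V :: "'a::ab_group_add set"
    and rscale :: "'a \<Rightarrow> quat \<Rightarrow> 'a"
    and N :: "'a \<Rightarrow> real"
  assumes zero_closed: "0 \<in> V"
    and add_closed: "x \<in> V \<Longrightarrow> y \<in> V \<Longrightarrow> x + y \<in> V"
    and rscale_closed: "x \<in> V \<Longrightarrow> rscale x a \<in> V"
    and rscale_add_left: "x \<in> V \<Longrightarrow> y \<in> V \<Longrightarrow> rscale (x + y) a = rscale x a + rscale y a"
    and rscale_add_right: "x \<in> V \<Longrightarrow> rscale x (a + b) = rscale x a + rscale x b"
    and rscale_rscale: "x \<in> V \<Longrightarrow> rscale (rscale x a) b = rscale x (a * b)"
    and rscale_one: "x \<in> V \<Longrightarrow> rscale x 1 = x"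
    and N_eq_0_iff: "x \<in> V \<Longrightarrow> N x = 0 \<longleftrightarrow> x = 0"
    and N_triangle: "x \<in> V \<Longrightarrow> y \<in> V \<Longrightarrow> N (x + y) \<le> N x + N y"
    and N_rscale: "x \<in> V \<Longrightarrow> N (rscale x a) = N x * norm a"

locale quat_right_banach_space = quat_right_normed_space +
  assumes complete:
    "range X \<subseteq> V \<Longrightarrow> (\<forall>e>0. \<exists>M. \<forall>m\<ge>M. \<forall>n\<ge>M. N (X m - X n) < e)
       \<Longrightarrow> \<exists>l\<in>V. (\<lambda>n. N (X n - l)) \<longlonglongrightarrow> 0"

definition equivalent_norms_on :: "'a set \<Rightarrow> ('a \<Rightarrow> real) \<Rightarrow> ('a \<Rightarrow> real) \<Rightarrow> bool" where
  "equivalent_norms_on V N1 N2 \<longleftrightarrow>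
     (\<exists>c>0. \<exists>C>0. \<forall>x\<in>V. c * N1 x \<le> N2 x \<and> N2 x \<le> C * N1 x)"

definition fun_rscale :: "(quat \<Rightarrow> quat) \<Rightarrow> quat \<Rightarrow> quat \<Rightarrow> quat" where
  "fun_rscale f a = (\<lambda>q. f q * a)"

end

theory Submission
  imports Defs "HOL-Complex_Analysis.Conformal_Mappings"
begin

text \<open>
  By the identity principle on each slice, \<open>f (x + J y)\<close> is a combination of \<open>f (x + I y)\<close> and
  \<open>f (x - I y)\<close> whose coefficients \<open>(1 \<plusminus> J I) / 2\<close> have norm at most \<open>1\<close>. The same formula holds for
  \<open>\<partial>f/\<partial>x\<^sub>0\<close>, which gives the factor \<open>2\<close> between the norms. For completeness, integrating
  \<open>\<partial>f/\<partial>x\<^sub>0\<close> from \<open>0\<close> bounds \<open>f\<close> pointwise by its Bloch norm, so a Cauchy sequence converges on every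
  slice together with its derivatives, locally uniformly. The limit inherits the representation
  formula, and this is what makes it real differentiable as a function of four variables.
\<close>

section \<open>Slices and the representation formula\<close>

text \<open>Differentiability along each slice says nothing about directions transverse to it, yet
  \<open>slice_regular\<close> demands real differentiability in four variables; supplying this for
  a limit is the main obstacle to completeness. Off the real axis, the unit and the complex
  coordinate of a quaternion can be chosen to depend differentiably on it, so the representation
  formula exhibits the limit as a composition of differentiable maps. On the real axis all slices
  meet and the norm of the imaginary part is not differentiable, so a direct estimate of the
  remainder is used there. The comparison of norms works because x + I y and x - I y have the same
  modulus as x + J y: the weight is the same at all three points and passes through the
  formula.\<close>

lemma of_real_quat_sel [simp]:
  "qx0 (of_real r) = r" "qx1 (of_real r) = 0" "qx2 (of_real r) = 0" "qx3 (of_real r) = 0"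
  by (simp_all add: of_real_def)

lemma mult_of_real_quat: "q * of_real r = r *\<^sub>R (q :: quat)"
  by (simp add: of_real_def)

text \<open>The isomorphism of the complex field onto \<open>slice_plane I\<close>. Taking complex
  numbers as coordinates makes complex analysis available and lets the same \<open>z\<close> name
  corresponding points of different slices.\<close>

definition slice_point :: "quat \<Rightarrow> complex \<Rightarrow> quat" where
  "slice_point I z = of_real (Re z) + I * of_real (Im z)"

lemma slice_point_sel [simp]:
  "I \<in> imag_unit_sphere \<Longrightarrow> qx0 (slice_point I z) = Re z"
  "qx1 (slice_point I z) = qx1 I * Im z"
  "qx2 (slice_point I z) = qx2 I * Im z"
  "qx3 (slice_point I z) = qx3 I * Im z"
  by (simp_all add: slice_point_def imag_unit_sphere_def)

lemma imag_unit_sphere_sum_squares: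
  "I \<in> imag_unit_sphere \<Longrightarrow> (qx1 I)\<^sup>2 + (qx2 I)\<^sup>2 + (qx3 I)\<^sup>2 = 1"
  by (auto simp: imag_unit_sphere_def norm_quat_def)

lemma imag_unit_sphere_square:
  assumes "I \<in> imag_unit_sphere" shows "I * I = - 1"
  using imag_unit_sphere_sum_squares[OF assms] assms
  by (simp add: quat_eq_iff imag_unit_sphere_def power2_eq_square)

lemma imag_unit_sphere_square_left:
  "I \<in> imag_unit_sphere \<Longrightarrow> I * (I * q) = - q"
  by (simp add: imag_unit_sphere_square flip: mult.assoc)

lemma slice_point_of_real [simp]: "slice_point I (of_real r) = of_real r"
  by (simp add: slice_point_def)

lemma slice_point_simps [simp]:
  "slice_point I 0 = 0" "slice_point I 1 = 1" "slice_point I \<i> = I"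
  by (simp_all add: slice_point_def)

lemma slice_point_add: "slice_point I (z + w) = slice_point I z + slice_point I w"
  by (simp add: slice_point_def algebra_simps)

lemma slice_point_diff: "slice_point I (z - w) = slice_point I z - slice_point I w"
  by (simp add: slice_point_def algebra_simps)

lemma slice_point_scaleR: "slice_point I (r *\<^sub>R z) = r *\<^sub>R slice_point I z"
  by (simp add: slice_point_def of_real_def algebra_simps)

lemma norm_slice_point [simp]:
  assumes "I \<in> imag_unit_sphere" shows "norm (slice_point I z) = cmod z"
proof -
  have "(qx1 I * Im z)\<^sup>2 + (qx2 I * Im z)\<^sup>2 + (qx3 I * Im z)\<^sup>2
      = ((qx1 I)\<^sup>2 + (qx2 I)\<^sup>2 + (qx3 I)\<^sup>2) * (Im z)\<^sup>2"
    by (simp add: algebra_simps)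
  then show ?thesis
    using assms imag_unit_sphere_sum_squares[OF assms]
    by (simp add: norm_quat_def cmod_def add.assoc)
qed

lemma bounded_linear_slice_point:
  assumes "I \<in> imag_unit_sphere" shows "bounded_linear (slice_point I)"
  by (rule bounded_linear_intro[where K = 1])
     (use assms in \<open>simp_all add: slice_point_add slice_point_scaleR\<close>)

lemma has_derivative_compose_slice_point:
  assumes I: "I \<in> imag_unit_sphere" and f: "(f has_derivative D) (at (slice_point I z))"
  shows "((\<lambda>z. f (slice_point I z)) has_derivative (\<lambda>w. D (slice_point I w))) (at z)"
proof -
  have "(slice_point I has_derivative slice_point I) (at z)"
    using bounded_linear_slice_point[OF I] by (rule bounded_linear_imp_has_derivative)
  from has_derivative_compose[OF this f] show ?thesis .
qed

lemma quat_slice_decomposition: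
  obtains I z where "I \<in> imag_unit_sphere" "q = slice_point I z"
proof -
  define n where "n = sqrt ((qx1 q)\<^sup>2 + (qx2 q)\<^sup>2 + (qx3 q)\<^sup>2)"
  show ?thesis
  proof (cases "n = 0")
    case True
    then have "qx1 q = 0" "qx2 q = 0" "qx3 q = 0"
      by (simp_all add: n_def add_nonneg_eq_0_iff)
    \<comment> \<open>A real quaternion lies in every slice, so any imaginary unit will do.\<close>
    then have "Quat 0 1 0 0 \<in> imag_unit_sphere" "q = slice_point (Quat 0 1 0 0) (of_real (qx0 q))"
      by (simp_all add: imag_unit_sphere_def norm_quat_def quat_eq_iff)
    then show ?thesis
      by (rule that)
  next
    case False
    define I where "I = Quat 0 (qx1 q / n) (qx2 q / n) (qx3 q / n)"
    have "n\<^sup>2 = (qx1 q)\<^sup>2 + (qx2 q)\<^sup>2 + (qx3 q)\<^sup>2"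
      by (simp add: n_def)
    with False have "(qx1 q)\<^sup>2 + (qx2 q)\<^sup>2 + (qx3 q)\<^sup>2 \<noteq> 0" by (metis power_not_zero)
    with \<open>n\<^sup>2 = _\<close> have "I \<in> imag_unit_sphere"
      by (simp add: imag_unit_sphere_def norm_quat_def I_def power_divide flip: add_divide_distrib)
    moreover from this False have "q = slice_point I (Complex (qx0 q) n)"
      by (simp add: quat_eq_iff) (simp add: I_def)
    ultimately show ?thesis
      by (rule that)
  qed
qed

lemma slice_point_in_unit_ball_iff [simp]:
  "I \<in> imag_unit_sphere \<Longrightarrow> slice_point I z \<in> unit_ball \<longleftrightarrow> cmod z < 1"
  by (simp add: unit_ball_def)

lemma slice_point_in_slice_ball_iff [simp]:
  "I \<in> imag_unit_sphere \<Longrightarrow> slice_point I z \<in> slice_ball I \<longleftrightarrow> cmod z < 1"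
  by (auto simp: slice_ball_def slice_plane_def slice_point_def
      simp flip: slice_point_in_unit_ball_iff)

lemma slice_ball_eq_image:
  assumes "I \<in> imag_unit_sphere" shows "slice_ball I = slice_point I ` ball 0 1"
proof -
  have "slice_plane I = range (slice_point I)"
    unfolding slice_plane_def slice_point_def image_def
    by (auto, metis complex.sel)
  with assms show ?thesis
    by (force simp: slice_ball_def)
qed

section \<open>Derivatives along a slice\<close>

lemma open_unit_ball: "open unit_ball"
  by (simp add: unit_ball_def)

lemma differentiable_at_unit_ball:
  "f differentiable_on unit_ball \<Longrightarrow> q \<in> unit_ball \<Longrightarrow> f differentiable (at q)"
  using differentiable_on_eq_differentiable_at[OF open_unit_ball] by blast

lemma partial_x0_eq:
  assumes "(f has_derivative D) (at q)"
  shows "partial_x0 f q = D 1"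
proof -
  have "(f has_derivative D) (at (q + of_real 0))"
    using assms by simp
  moreover have "((\<lambda>t::real. q + of_real t) has_derivative (\<lambda>t. of_real t)) (at 0)"
    by (auto intro!: derivative_eq_intros)
  ultimately have "((\<lambda>t. f (q + of_real t)) has_derivative (\<lambda>t. D (of_real t))) (at 0)"
    using has_derivative_compose by blast
  moreover have "D (of_real t) = t *\<^sub>R D 1" for t
    using has_derivative_linear[OF assms] by (simp add: of_real_def linear_cmul)
  ultimately show ?thesis
    by (auto simp: partial_x0_def has_vector_derivative_def intro!: vector_derivative_at)
qed

lemma vector_derivative_along_slice:
  fixes i :: quat
  assumes "(f has_derivative D) (at (of_real x + i * of_real y))"
  shows "vector_derivative (\<lambda>s. f (of_real s + i * of_real y)) (at x) = D 1"
    and "vector_derivative (\<lambda>t. f (of_real x + i * of_real t)) (at y) = D i"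
proof -
  have lin: "D (t *\<^sub>R v) = t *\<^sub>R D v" for t v
    using has_derivative_linear[OF assms] by (simp add: linear_cmul)
  have "((\<lambda>s. of_real s + i * of_real y) has_derivative (\<lambda>s. of_real s)) (at x)"
    by (auto intro!: derivative_eq_intros)
  from has_derivative_compose[OF this assms]
  show "vector_derivative (\<lambda>s. f (of_real s + i * of_real y)) (at x) = D 1"
    by (auto simp: has_vector_derivative_def of_real_def lin intro!: vector_derivative_at)
  have "((\<lambda>t. of_real x + i * of_real t) has_derivative (\<lambda>t. t *\<^sub>R i)) (at y)"
    unfolding mult_of_real_quat by (auto intro!: derivative_eq_intros)
  from has_derivative_compose[OF this assms]
  show "vector_derivative (\<lambda>t. f (of_real x + i * of_real t)) (at y) = D i"
    by (auto simp: has_vector_derivative_def lin intro!: vector_derivative_at)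
qed

text \<open>Complex differentiability for quaternion-valued maps: the differential is left linear
  over \<open>slice_plane I\<close>. The constant stands on the right because the unit acts from the
  left in the slice equation.\<close>

definition has_slice_derivative :: "quat \<Rightarrow> (complex \<Rightarrow> quat) \<Rightarrow> quat \<Rightarrow> complex \<Rightarrow> bool" where
  "has_slice_derivative I h c z \<longleftrightarrow> (h has_derivative (\<lambda>w. slice_point I w * c)) (at z)"

text \<open>A real linear map on the complex plane is determined by its values at \<open>1\<close>
  and \<open>\<i>\<close>; the last hypothesis is the Cauchy-Riemann equation relating them.\<close>

lemma has_slice_derivativeI:
  assumes "I \<in> imag_unit_sphere" "(h has_derivative D) (at z)" "D \<i> = I * D 1"
  shows "has_slice_derivative I h (D 1) z"
proof -
  interpret linear D
    using assms(2) by (rule has_derivative_linear)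
  have "D w = slice_point I w * D 1" for w
  proof -
    have w: "w = Re w *\<^sub>R 1 + Im w *\<^sub>R \<i>"
      by (simp add: complex_eq_iff)
    show ?thesis
      by (subst w, unfold add scale assms(3))
       (simp add: slice_point_def of_real_def algebra_simps)
  qed
  then have "D = (\<lambda>w. slice_point I w * D 1)"
    by blast
  with assms(2) show ?thesis
    unfolding has_slice_derivative_def by metis
qed

text \<open>Left multiplication by \<open>I\<close> turns the slice equation
  \<open>D 1 + I * D I = 0\<close> into \<open>D I = I * D 1\<close>, which is the Cauchy-Riemann
  condition for the pullback to the disc.\<close>

lemma slice_regular_has_slice_derivative:
  assumes f: "slice_regular f" and I: "I \<in> imag_unit_sphere" and z: "cmod z < 1"
  shows "has_slice_derivative I (\<lambda>z. f (slice_point I z)) (partial_x0 f (slice_point I z)) z"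
proof -
  have "f differentiable (at (slice_point I z))"
    using conjunct1[OF f[unfolded slice_regular_def]] I z by (intro differentiable_at_unit_ball) simp_all
  then obtain D where D: "(f has_derivative D) (at (slice_point I z))"
    by (auto simp: differentiable_def)
  have "of_real (Re z) + I * of_real (Im z) \<in> slice_ball I"
    using slice_point_in_slice_ball_iff[OF I, of z] z by (simp add: slice_point_def)
  from conjunct2[OF f[unfolded slice_regular_def], THEN bspec, OF I, rule_format, OF this]
  have "vector_derivative (\<lambda>s. f (of_real s + I * of_real (Im z))) (at (Re z))
      + I * vector_derivative (\<lambda>t. f (of_real (Re z) + I * of_real t)) (at (Im z)) = 0" .
  then have "D 1 + I * D I = 0"
    unfolding vector_derivative_along_slice[OF D[unfolded slice_point_def]] .
  then have "I * (D 1 + I * D I) = 0"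
    by simp
  then have *: "D I = I * D 1"
    unfolding distrib_left imag_unit_sphere_square_left[OF I] by simp
  have "((\<lambda>z. f (slice_point I z)) has_derivative (\<lambda>w. D (slice_point I w))) (at z)"
    by (rule has_derivative_compose_slice_point[OF I D])
  then have "has_slice_derivative I (\<lambda>z. f (slice_point I z)) (D (slice_point I 1)) z"
    by (rule has_slice_derivativeI[OF I]) (simp only: slice_point_simps *)
  then show ?thesis
    by (simp only: slice_point_simps partial_x0_eq[OF D])
qed

text \<open>Uniqueness of derivatives identifies the total derivative, restricted to the slice, with
  left multiplication onto \<open>c\<close>; its values at \<open>1\<close> and \<open>I\<close>
  then satisfy the slice equation.\<close>

lemma slice_regularI:
  assumes "f differentiable_on unit_ball"
    and "\<And>I z. I \<in> imag_unit_sphere \<Longrightarrow> cmod z < 1 \<Longrightarrow> \<exists>c. has_slice_derivative I (\<lambda>z. f (slice_point I z)) c z"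
  shows "slice_regular f"
  unfolding slice_regular_def
proof (intro conjI ballI allI impI)
  fix I x y
  assume I: "I \<in> imag_unit_sphere" and xy: "of_real x + I * of_real y \<in> slice_ball I"
  define z where "z = Complex x y"
  have q: "of_real x + I * of_real y = slice_point I z"
    by (simp add: z_def slice_point_def)
  with xy I have z: "cmod z < 1"
    by simp
  have "f differentiable (at (slice_point I z))"
    using assms(1) I z by (intro differentiable_at_unit_ball) simp_all
  then obtain D where D: "(f has_derivative D) (at (slice_point I z))"
    by (auto simp: differentiable_def)
  have D1: "((\<lambda>z. f (slice_point I z)) has_derivative (\<lambda>w. D (slice_point I w))) (at z)"
    by (rule has_derivative_compose_slice_point[OF I D])
  obtain c where "has_slice_derivative I (\<lambda>z. f (slice_point I z)) c z"
    using assms(2) I z by blast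
  from has_derivative_unique[OF D1 this[unfolded has_slice_derivative_def]]
  have eq: "D (slice_point I w) = slice_point I w * c" for w
    by metis
  from eq[of 1] eq[of \<i>] have "D 1 + I * D I = 0"
    by (simp add: imag_unit_sphere_square_left[OF I])
  then show "vector_derivative (\<lambda>s. f (of_real s + I * of_real y)) (at x)
      + I * vector_derivative (\<lambda>t. f (of_real x + I * of_real t)) (at y) = 0"
    using vector_derivative_along_slice[OF D[folded q]] by simp
qed (rule assms(1))

section \<open>Identity principle and representation formula\<close>

text \<open>For fixed \<open>v\<close>, \<open>p \<mapsto> \<langle>p, v\<rangle> + \<i> \<langle>p, I v\<rangle>\<close> intertwines left multiplication by \<open>I\<close> with
  multiplication by \<open>\<i>\<close>. It plays the role of the splitting lemma and needs no choice of a
  unit orthogonal to \<open>I\<close>.\<close>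

definition slice_coord :: "quat \<Rightarrow> quat \<Rightarrow> quat \<Rightarrow> complex" where
  "slice_coord I v p = Complex (p \<bullet> v) (p \<bullet> (I * v))"

text \<open>Left multiplication by an imaginary unit is skew-adjoint for the inner product and
  squares to -1.\<close>

lemma slice_coord_slice_point_mult:
  assumes "I \<in> imag_unit_sphere"
  shows "slice_coord I v (slice_point I w * p) = w * slice_coord I v p"
proof -
  have adj: "(I * p) \<bullet> v = - (p \<bullet> (I * v))" for p v
    using assms by (simp add: imag_unit_sphere_def inner_quat_def algebra_simps)
  have "slice_point I w * p = Re w *\<^sub>R p + Im w *\<^sub>R (I * p)"
    by (simp add: slice_point_def of_real_def algebra_simps)
  then show ?thesis
    using imag_unit_sphere_square_left[OF assms]
    by (simp add: slice_coord_def complex_eq_iff inner_add_left adj algebra_simps)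
qed

text \<open>The choice \<open>v = p\<close> makes the real part the squared norm of
  \<open>p\<close>.\<close>

lemma slice_coord_eq_0D: "(\<And>v. slice_coord I v p = 0) \<Longrightarrow> p = 0"
  by (metis inner_eq_zero_iff complex.sel(1) slice_coord_def zero_complex.sel(1))

lemma bounded_linear_slice_coord: "bounded_linear (slice_coord I v)"
proof -
  have "slice_coord I v = (\<lambda>p. (p \<bullet> v) *\<^sub>R 1 + (p \<bullet> (I * v)) *\<^sub>R \<i>)"
    by (auto simp: slice_coord_def complex_eq_iff)
  then show ?thesis
    by (simp only:) (intro bounded_linear_add bounded_linear_scaleR_const bounded_linear_inner_left)
qed

lemma slice_coord_has_field_derivative:
  assumes "I \<in> imag_unit_sphere" "has_slice_derivative I h c z"
  shows "((\<lambda>z. slice_coord I v (h z)) has_field_derivative slice_coord I v c) (at z)"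
  using bounded_linear.has_derivative[OF bounded_linear_slice_coord[of I v] assms(2)[unfolded has_slice_derivative_def]]
  by (simp add: has_field_derivative_def slice_coord_slice_point_mult[OF assms(1)] mult_commute_abs)

text \<open>Every coordinate \<open>slice_coord I v\<close> of \<open>h\<close> is holomorphic on
  the disc and vanishes on a real interval accumulating at 0, so the classical identity theorem
  applies to each of them.\<close>

lemma slice_identity_principle:
  assumes I: "I \<in> imag_unit_sphere"
    and h: "\<And>z. cmod z < 1 \<Longrightarrow> \<exists>c. has_slice_derivative I h c z"
    and zero: "\<And>x::real. \<bar>x\<bar> < 1 \<Longrightarrow> h (of_real x) = 0"
    and z: "cmod z < 1"
  shows "h z = 0"
proof (rule slice_coord_eq_0D)
  fix v
  define g where "g = (\<lambda>z. slice_coord I v (h z))"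
  have "(g has_field_derivative slice_coord I v c) (at z)" if "has_slice_derivative I h c z" for c z
    unfolding g_def using I that by (rule slice_coord_has_field_derivative)
  then have "g holomorphic_on ball 0 1"
    using h unfolding holomorphic_on_open[OF open_ball] by (metis mem_ball_0)
  moreover have "(0::complex) islimpt of_real ` {-1<..<1}"
  proof (unfold islimpt_approachable, intro allI impI)
    fix e :: real assume "e > 0"
    then show "\<exists>x'\<in>of_real ` {-1<..<1}. x' \<noteq> (0::complex) \<and> dist x' 0 < e"
      by (intro bexI[of _ "of_real (min (e/2) (1/2))"]) auto
  qed
  moreover have "g w = 0" if "w \<in> of_real ` {-1<..<1}" for w
    using that zero unfolding g_def
    by (auto simp: slice_coord_def complex_eq_iff)
  moreover have "of_real ` {-1<..<1} \<subseteq> ball (0::complex) 1"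
    by auto
  ultimately have "g z = 0"
    using analytic_continuation[of g "ball 0 1" "of_real ` {-1<..<1}" 0 z] z by simp
  then show "slice_coord I v (h z) = 0"
    by (simp add: g_def)
qed

text \<open>The extension operator from the slice of \<open>I\<close> to that of \<open>J\<close>.
  Regrouped, it reads a + J b with a = (h(z) + h(cnj z))/2 and b = I (h(cnj z) - h(z))/2, the two
  components of the stem function.\<close>

definition slice_mix :: "quat \<Rightarrow> quat \<Rightarrow> (complex \<Rightarrow> quat) \<Rightarrow> complex \<Rightarrow> quat" where
  "slice_mix I J h z = (1/2) *\<^sub>R ((1 - J * I) * h z + (1 + J * I) * h (cnj z))"

lemma slice_mix_of_real: "slice_mix I J h (of_real x) = h (of_real x)"
proof -
  have "(1 - J * I) * p + (1 + J * I) * p = 2 *\<^sub>R p" for p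
    by (simp add: left_diff_distrib distrib_right scaleR_2)
  then show ?thesis
    by (simp add: slice_mix_def)
qed

lemma norm_slice_mix_le:
  assumes "I \<in> imag_unit_sphere" "J \<in> imag_unit_sphere"
  shows "norm (slice_mix I J h z) \<le> norm (h z) + norm (h (cnj z))"
proof -
  have *: "norm (J * I) = 1"
    using assms by (simp add: imag_unit_sphere_def norm_mult)
  have "norm (1 - J * I) \<le> 2" "norm (1 + J * I) \<le> 2"
    using norm_triangle_ineq4[of 1 "J * I"] norm_triangle_ineq[of 1 "J * I"] * by simp_all
  then have "norm ((1 - J * I) * h z + (1 + J * I) * h (cnj z)) \<le> 2 * norm (h z) + 2 * norm (h (cnj z))"
    by (intro norm_triangle_le add_mono) (simp_all add: norm_mult mult_right_mono)
  then show ?thesis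
    by (simp add: slice_mix_def)
qed

text \<open>The coefficients exchange the units: (1 - J I) I = J (1 - J I) and (1 + J I) I = - J (1
  + J I). The sign in the second identity cancels the one produced by conjugation.\<close>

lemma slice_mix_has_slice_derivative:
  assumes I: "I \<in> imag_unit_sphere" and J: "J \<in> imag_unit_sphere"
    and h: "has_slice_derivative I h (d z) z" "has_slice_derivative I h (d (cnj z)) (cnj z)"
  shows "has_slice_derivative J (slice_mix I J h) (slice_mix I J d z) z"
proof -
  have cnj: "(cnj has_derivative cnj) (at z)"
    by (rule bounded_linear_imp_has_derivative[OF bounded_linear_cnj])
  have "((\<lambda>z. h (cnj z)) has_derivative (\<lambda>w. slice_point I (cnj w) * d (cnj z))) (at z)"
    using has_derivative_compose[OF cnj h(2)[unfolded has_slice_derivative_def]] .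
  then have D: "(slice_mix I J h has_derivative
      (\<lambda>w. (1/2) *\<^sub>R ((1 - J * I) * (slice_point I w * d z)
         + (1 + J * I) * (slice_point I (cnj w) * d (cnj z))))) (at z)"
    unfolding slice_mix_def
    using h(1) unfolding has_slice_derivative_def
    by (auto intro!: derivative_eq_intros)
  have "slice_point I (cnj \<i>) = - I"
    by (simp add: slice_point_def)
  moreover have "(1 - J * I) * I = J * (1 - J * I)" "(1 + J * I) * I = - (J * (1 + J * I))"
    using I J by (simp_all add: algebra_simps imag_unit_sphere_square imag_unit_sphere_square_left)
  ultimately have "(1 - J * I) * (slice_point I \<i> * d z) + (1 + J * I) * (slice_point I (cnj \<i>) * d (cnj z))
      = J * ((1 - J * I) * d z + (1 + J * I) * d (cnj z))"
    by (simp only: distrib_left mult_minus_right mult_minus_left minus_minus slice_point_simps flip: mult.assoc)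
  with has_slice_derivativeI[OF J D] show ?thesis
    by (simp add: slice_mix_def)
qed

lemma has_slice_derivative_diff:
  assumes "has_slice_derivative I g c z" "has_slice_derivative I h d z"
  shows "has_slice_derivative I (\<lambda>z. g z - h z) (c - d) z"
  using assms unfolding has_slice_derivative_def
  by (auto intro!: derivative_eq_intros simp: right_diff_distrib)

lemma has_slice_derivative_unique:
  assumes "has_slice_derivative I h c z" "has_slice_derivative I h d z"
  shows "c = d"
  using has_derivative_unique[OF assms[unfolded has_slice_derivative_def]]
  by (metis mult_1 slice_point_simps(2))

text \<open>Both sides are slice differentiable for \<open>J\<close> and agree on the real segment,
  where the terms with \<open>J * I\<close> cancel, so the identity principle applies to their
  difference.\<close>

lemma representation_formula:
  assumes f: "slice_regular f" and I: "I \<in> imag_unit_sphere" and J: "J \<in> imag_unit_sphere"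
    and z: "cmod z < 1"
  shows "f (slice_point J z) = slice_mix I J (\<lambda>z. f (slice_point I z)) z"
proof -
  let ?h = "\<lambda>z. f (slice_point J z) - slice_mix I J (\<lambda>z. f (slice_point I z)) z"
  have "\<exists>c. has_slice_derivative J ?h c z" if z: "cmod z < 1" for z
  proof
    show "has_slice_derivative J ?h (partial_x0 f (slice_point J z) - slice_mix I J (\<lambda>z. partial_x0 f (slice_point I z)) z) z"
      using slice_regular_has_slice_derivative[OF f I] z
      by (intro has_slice_derivative_diff slice_regular_has_slice_derivative[OF f J]
          slice_mix_has_slice_derivative I J) simp_all
  qed
  then have "?h z = 0"
    by (rule slice_identity_principle[OF J _ _ z]) (simp_all add: slice_mix_of_real)
  then show ?thesis
    by simp
qed

lemma partial_x0_representation_formula: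
  assumes f: "slice_regular f" and I: "I \<in> imag_unit_sphere" and J: "J \<in> imag_unit_sphere"
    and z: "cmod z < 1"
  shows "partial_x0 f (slice_point J z) = slice_mix I J (\<lambda>z. partial_x0 f (slice_point I z)) z"
proof -
  let ?d = "\<lambda>z. partial_x0 f (slice_point I z)"
  have "has_slice_derivative J (slice_mix I J (\<lambda>z. f (slice_point I z))) (slice_mix I J ?d z) z"
    using slice_regular_has_slice_derivative[OF f I] z
    by (intro slice_mix_has_slice_derivative I J) simp_all
  then have "has_slice_derivative J (\<lambda>z. f (slice_point J z)) (slice_mix I J ?d z) z"
    unfolding has_slice_derivative_def using z representation_formula[OF f I J]
    by (elim has_derivative_transform_within_open[where s = "ball 0 1"]) simp_all
  with slice_regular_has_slice_derivative[OF f J z] show ?thesis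
    by (rule has_slice_derivative_unique)
qed

section \<open>Bloch norms\<close>

text \<open>\<open>restrict\<close> is arbitrary off the slice, but a small real increment stays
  both in the slice and in the ball, so the derivative at \<open>q\<close> never sees those
  values.\<close>

lemma partial_x0_slice_restriction:
  assumes i: "i \<in> imag_unit_sphere" and q: "q \<in> slice_ball i"
  shows "partial_x0 (slice_restriction i f) q = partial_x0 f q"
proof -
  obtain z where z: "cmod z < 1" "q = slice_point i z"
    using q unfolding slice_ball_eq_image[OF i] by auto
  have "open ((\<lambda>t::real. z + of_real t) -` ball 0 1)"
    by (intro open_vimage continuous_intros) auto
  then have "\<forall>\<^sub>F t in nhds 0. t \<in> (\<lambda>t::real. z + of_real t) -` ball 0 1"
    using z(1) by (intro eventually_nhds_in_open) simp_all
  then have "\<forall>\<^sub>F t in nhds 0. slice_restriction i f (q + of_real t) = f (q + of_real t)"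
  proof eventually_elim
    case (elim t)
    then have "slice_point i (z + of_real t) \<in> slice_ball i"
      using i by simp
    then show ?case
      by (simp add: z(2) slice_point_add slice_restriction_def)
  qed
  then show ?thesis
    unfolding partial_x0_def by (intro vector_derivative_cong_eq) (auto elim: eventually_mono)
qed

definition bloch_density :: "(quat \<Rightarrow> quat) \<Rightarrow> quat \<Rightarrow> real" where
  "bloch_density f q = (1 - (norm q)\<^sup>2) * norm (partial_x0 f q)"

lemma one_minus_norm_squared_pos: "q \<in> unit_ball \<Longrightarrow> 0 < 1 - (norm q)\<^sup>2"
  by (simp add: unit_ball_def abs_square_less_1)

lemma bloch_density_nonneg: "q \<in> unit_ball \<Longrightarrow> 0 \<le> bloch_density f q"
  using one_minus_norm_squared_pos[of q] by (simp add: bloch_density_def)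

lemma slice_regular_functionsD:
  assumes "f \<in> slice_regular_functions"
  shows "slice_regular f" "q \<notin> unit_ball \<Longrightarrow> f q = 0"
  using assms by (auto simp: slice_regular_functions_def)

lemma mem_bloch_iff:
  "f \<in> bloch \<longleftrightarrow> f \<in> slice_regular_functions \<and> bdd_above (bloch_density f ` unit_ball)"
  by (simp add: bloch_def bloch_density_def [abs_def])

lemma bloch_norm_eq: "bloch_norm f = norm (f 0) + (SUP q\<in>unit_ball. bloch_density f q)"
  by (simp add: bloch_norm_def bloch_density_def)

lemma mem_slice_bloch_iff:
  assumes "i \<in> imag_unit_sphere"
  shows "f \<in> slice_bloch i \<longleftrightarrow>
    f \<in> slice_regular_functions \<and> bdd_above (bloch_density f ` slice_ball i)"
proof -
  have "(\<lambda>z. (1 - (norm z)\<^sup>2) * norm (partial_x0 (slice_restriction i f) z)) ` slice_ball i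
      = bloch_density f ` slice_ball i"
    by (intro image_cong) (simp_all add: bloch_density_def partial_x0_slice_restriction[OF assms])
  then show ?thesis
    by (simp add: slice_bloch_def)
qed

lemma slice_bloch_norm_eq:
  assumes "i \<in> imag_unit_sphere"
  shows "slice_bloch_norm i f = norm (f 0) + (SUP q\<in>slice_ball i. bloch_density f q)"
  unfolding slice_bloch_norm_def
  by (intro arg_cong2[where f = "(+)"] SUP_cong refl)
     (simp add: bloch_density_def partial_x0_slice_restriction[OF assms])

lemma zero_in_unit_ball [simp]: "0 \<in> unit_ball"
  by (simp add: unit_ball_def)

lemma unit_ball_nonempty [simp]: "unit_ball \<noteq> {}"
  using zero_in_unit_ball by blast

lemma slice_ball_subset: "slice_ball i \<subseteq> unit_ball"
  by (simp add: slice_ball_def)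

lemma zero_in_slice_ball: "i \<in> imag_unit_sphere \<Longrightarrow> 0 \<in> slice_ball i"
  by (metis norm_zero slice_point_in_slice_ball_iff slice_point_simps(1) zero_less_one)

text \<open>The factor 2 counts the points \<open>z\<close> and \<open>cnj z\<close>, each
  contributing at most \<open>B\<close> because their weight equals that of
  \<open>q\<close>.\<close>

lemma bloch_density_slice_bound:
  assumes f: "slice_regular f" and i: "i \<in> imag_unit_sphere" and q: "q \<in> unit_ball"
    and B: "\<And>p. p \<in> slice_ball i \<Longrightarrow> bloch_density f p \<le> B"
  shows "bloch_density f q \<le> 2 * B"
proof -
  obtain J z where J: "J \<in> imag_unit_sphere" and qz: "q = slice_point J z"
    by (rule quat_slice_decomposition)
  with q have z: "cmod z < 1"
    by simp
  have "bloch_density f q \<le> bloch_density f (slice_point i z) + bloch_density f (slice_point i (cnj z))"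
    using norm_slice_mix_le[OF i J, of "\<lambda>z. partial_x0 f (slice_point i z)" z]
      one_minus_norm_squared_pos[OF q] i J
    unfolding qz bloch_density_def partial_x0_representation_formula[OF f i J z]
    by (simp add: distrib_left flip: distrib_left)
  also have "\<dots> \<le> B + B"
    using z i by (intro add_mono B) simp_all
  finally show ?thesis
    by simp
qed

lemma slice_bloch_eq_bloch:
  assumes i: "i \<in> imag_unit_sphere"
  shows "slice_bloch i = bloch"
proof (intro set_eqI iffI)
  fix f assume "f \<in> slice_bloch i"
  then have f: "f \<in> slice_regular_functions" and "bdd_above (bloch_density f ` slice_ball i)"
    by (simp_all add: mem_slice_bloch_iff[OF i])
  then obtain B where "\<And>p. p \<in> slice_ball i \<Longrightarrow> bloch_density f p \<le> B"
    by (auto simp: bdd_above_def)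
  from bloch_density_slice_bound[OF slice_regular_functionsD(1)[OF f] i _ this]
  show "f \<in> bloch"
    using f by (auto simp: mem_bloch_iff bdd_above_def)
next
  fix f assume "f \<in> bloch"
  then show "f \<in> slice_bloch i"
    using slice_ball_subset[of i]
    by (auto simp: mem_slice_bloch_iff[OF i] mem_bloch_iff intro: bdd_above_mono[OF _ image_mono])
qed

lemma slice_bloch_norm_le_bloch_norm:
  assumes i: "i \<in> imag_unit_sphere" and f: "f \<in> bloch"
  shows "slice_bloch_norm i f \<le> bloch_norm f"
  using f zero_in_slice_ball[OF i] slice_ball_subset[of i]
  unfolding slice_bloch_norm_eq[OF i] bloch_norm_eq mem_bloch_iff
  by (intro add_left_mono cSUP_subset_mono) auto

lemma bloch_norm_le_slice_bloch_norm:
  assumes i: "i \<in> imag_unit_sphere" and f: "f \<in> bloch"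
  shows "bloch_norm f \<le> 2 * slice_bloch_norm i f"
proof -
  have "bdd_above (bloch_density f ` slice_ball i)" and reg: "slice_regular f"
    using f by (simp_all add: mem_slice_bloch_iff[OF i] slice_regular_functionsD flip: slice_bloch_eq_bloch[OF i])
  then have *: "bloch_density f p \<le> (SUP q\<in>slice_ball i. bloch_density f q)" if "p \<in> slice_ball i" for p
    using that by (simp add: cSUP_upper)
  have "(SUP q\<in>unit_ball. bloch_density f q) \<le> 2 * (SUP q\<in>slice_ball i. bloch_density f q)"
    by (intro cSUP_least bloch_density_slice_bound[OF reg i] *) auto
  \<comment> \<open>Only the supremum needs the factor 2; for \<open>norm (f 0)\<close> the doubling
    is mere nonnegativity.\<close>
  then show ?thesis
    by (simp add: bloch_norm_eq slice_bloch_norm_eq[OF i] add_increasing)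
qed

section \<open>Right linear structure and norm axioms\<close>

lemma slice_regular_has_derivative:
  assumes "slice_regular f" "q \<in> unit_ball"
  obtains D where "(f has_derivative D) (at q)"
  using differentiable_at_unit_ball[OF conjunct1[OF assms(1)[unfolded slice_regular_def]] assms(2)]
  unfolding differentiable_def by blast

lemma slice_regular_differentiable_on: "slice_regular f \<Longrightarrow> f differentiable_on unit_ball"
  unfolding slice_regular_def by blast

lemma slice_regular_add:
  assumes f: "slice_regular f" and g: "slice_regular g"
  shows "slice_regular (f + g)"
proof (rule slice_regularI)
  show "f + g differentiable_on unit_ball"
    unfolding plus_fun_def
    using f g by (intro differentiable_on_add slice_regular_differentiable_on)
  show "\<exists>c. has_slice_derivative I (\<lambda>z. (f + g) (slice_point I z)) c z"
    if "I \<in> imag_unit_sphere" "cmod z < 1" for I z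
    using slice_regular_has_slice_derivative[OF f that] slice_regular_has_slice_derivative[OF g that]
    unfolding has_slice_derivative_def plus_fun_def
    by (intro exI[of _ "partial_x0 f (slice_point I z) + partial_x0 g (slice_point I z)"])
       (auto intro!: derivative_eq_intros simp: distrib_left)
qed

lemma slice_regular_rscale:
  assumes f: "slice_regular f"
  shows "slice_regular (fun_rscale f a)"
proof (rule slice_regularI)
  show "fun_rscale f a differentiable_on unit_ball"
    unfolding fun_rscale_def
    using f by (intro differentiable_on_mult differentiable_on_const slice_regular_differentiable_on)
  show "\<exists>c. has_slice_derivative I (\<lambda>z. fun_rscale f a (slice_point I z)) c z"
    if "I \<in> imag_unit_sphere" "cmod z < 1" for I z
    using slice_regular_has_slice_derivative[OF f that]
    unfolding has_slice_derivative_def fun_rscale_def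
    by (intro exI[of _ "partial_x0 f (slice_point I z) * a"])
       (auto intro!: derivative_eq_intros simp: mult.assoc)
qed

lemma partial_x0_add:
  assumes "slice_regular f" "slice_regular g" "q \<in> unit_ball"
  shows "partial_x0 (f + g) q = partial_x0 f q + partial_x0 g q"
proof -
  obtain D E where D: "(f has_derivative D) (at q)" and E: "(g has_derivative E) (at q)"
    using assms slice_regular_has_derivative by metis
  show ?thesis
    unfolding partial_x0_eq[OF D] partial_x0_eq[OF E] plus_fun_def
      partial_x0_eq[OF has_derivative_add[OF D E]] ..
qed

lemma partial_x0_rscale:
  assumes "slice_regular f" "q \<in> unit_ball"
  shows "partial_x0 (fun_rscale f a) q = partial_x0 f q * a"
proof -
  obtain D where D: "(f has_derivative D) (at q)"
    using assms slice_regular_has_derivative by metis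
  show ?thesis
    unfolding partial_x0_eq[OF D] fun_rscale_def
      partial_x0_eq[OF has_derivative_mult_left[OF D]] ..
qed

text \<open>Reduces all closure and derivative rules for differences to those for sums and right
  multiples.\<close>

lemma fun_diff_eq_add_rscale: "f - g = f + fun_rscale g (- 1)"
  by (simp add: fun_eq_iff fun_rscale_def)

lemma slice_regular_diff: "slice_regular f \<Longrightarrow> slice_regular g \<Longrightarrow> slice_regular (f - g)"
  by (simp add: fun_diff_eq_add_rscale slice_regular_add slice_regular_rscale)

lemma partial_x0_diff:
  "slice_regular f \<Longrightarrow> slice_regular g \<Longrightarrow> q \<in> unit_ball
    \<Longrightarrow> partial_x0 (f - g) q = partial_x0 f q - partial_x0 g q"
  by (simp add: fun_diff_eq_add_rscale partial_x0_add partial_x0_rscale slice_regular_rscale)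

lemma bloch_density_add_le:
  assumes "slice_regular f" "slice_regular g" "q \<in> unit_ball"
  shows "bloch_density (f + g) q \<le> bloch_density f q + bloch_density g q"
  using one_minus_norm_squared_pos[OF assms(3)]
  by (simp add: bloch_density_def partial_x0_add[OF assms] norm_triangle_ineq flip: distrib_left)

lemma bloch_density_rscale:
  assumes "slice_regular f" "q \<in> unit_ball"
  shows "bloch_density (fun_rscale f a) q = bloch_density f q * norm a"
  by (simp add: bloch_density_def partial_x0_rscale[OF assms] norm_mult)

lemma bloch_norm_upper:
  assumes "f \<in> bloch" "q \<in> unit_ball"
  shows "norm (f 0) + bloch_density f q \<le> bloch_norm f"
  using assms by (simp add: bloch_norm_eq mem_bloch_iff cSUP_upper)

lemma bloch_norm_least:
  assumes "\<And>q. q \<in> unit_ball \<Longrightarrow> norm (f 0) + bloch_density f q \<le> B"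
  shows "bloch_norm f \<le> B"
proof -
  have "(SUP q\<in>unit_ball. bloch_density f q) \<le> B - norm (f 0)"
    using assms by (intro cSUP_least) (auto simp: algebra_simps)
  then show ?thesis
    by (simp add: bloch_norm_eq)
qed

lemma blochI:
  assumes "f \<in> slice_regular_functions" "\<And>q. q \<in> unit_ball \<Longrightarrow> bloch_density f q \<le> B"
  shows "f \<in> bloch"
  using assms by (auto simp: mem_bloch_iff bdd_above_def)

lemma bloch_slice_regular: "f \<in> bloch \<Longrightarrow> slice_regular f"
  and bloch_outside: "f \<in> bloch \<Longrightarrow> q \<notin> unit_ball \<Longrightarrow> f q = 0"
  by (simp_all add: mem_bloch_iff slice_regular_functions_def)

lemma bloch_add:
  assumes f: "f \<in> bloch" and g: "g \<in> bloch"
  shows "f + g \<in> bloch" "bloch_norm (f + g) \<le> bloch_norm f + bloch_norm g"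
proof -
  have *: "norm ((f + g) 0) + bloch_density (f + g) q \<le> bloch_norm f + bloch_norm g"
    if "q \<in> unit_ball" for q
    using bloch_norm_upper[OF f that] bloch_norm_upper[OF g that] norm_triangle_ineq[of "f 0" "g 0"]
      bloch_density_add_le[OF bloch_slice_regular[OF f] bloch_slice_regular[OF g] that] by simp
  then show "bloch_norm (f + g) \<le> bloch_norm f + bloch_norm g"
    by (rule bloch_norm_least)
  have "f + g \<in> slice_regular_functions"
    using f g by (simp add: slice_regular_functions_def slice_regular_add bloch_slice_regular bloch_outside)
  moreover have "bloch_density (f + g) q \<le> bloch_norm f + bloch_norm g" if "q \<in> unit_ball" for q
    using *[OF that] norm_ge_zero[of "(f + g) 0"] by linarith
  ultimately show "f + g \<in> bloch"
    by (rule blochI)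
qed

lemma bloch_rscale:
  assumes f: "f \<in> bloch"
  shows "fun_rscale f a \<in> bloch"
proof (rule blochI)
  show "fun_rscale f a \<in> slice_regular_functions"
    using f slice_regular_rscale[OF bloch_slice_regular[OF f]]
    by (simp add: slice_regular_functions_def bloch_outside) (simp add: fun_rscale_def bloch_outside)
  show "bloch_density (fun_rscale f a) q \<le> bloch_norm f * norm a" if "q \<in> unit_ball" for q
    unfolding bloch_density_rscale[OF bloch_slice_regular[OF f] that]
    using bloch_norm_upper[OF f that] norm_ge_zero[of "f 0"]
    by (intro mult_right_mono norm_ge_zero) linarith
qed

lemma bloch_diff: "f \<in> bloch \<Longrightarrow> g \<in> bloch \<Longrightarrow> f - g \<in> bloch"
  by (simp add: fun_diff_eq_add_rscale bloch_add bloch_rscale)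

lemma SUP_mult_right_real:
  fixes g :: "'a \<Rightarrow> real"
  assumes "A \<noteq> {}" "bdd_above (g ` A)" "0 \<le> c"
  shows "(SUP x\<in>A. g x * c) = (SUP x\<in>A. g x) * c"
proof (cases "c = 0")
  case False
  with \<open>0 \<le> c\<close> have c: "0 < c" by simp
  show ?thesis
  proof (rule cSup_eq_non_empty)
    show "(\<lambda>x. g x * c) ` A \<noteq> {}"
      using assms by simp
    show "y \<le> (SUP x\<in>A. g x) * c" if "y \<in> (\<lambda>x. g x * c) ` A" for y
      using that assms by (auto intro!: mult_right_mono cSUP_upper)
    show "(SUP x\<in>A. g x) * c \<le> y" if "\<And>x. x \<in> (\<lambda>x. g x * c) ` A \<Longrightarrow> x \<le> y" for y
    proof -
      have "(SUP x\<in>A. g x) \<le> y / c"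
        using that c assms by (intro cSUP_least) (auto simp: field_simps)
      then show ?thesis
        using c by (simp add: field_simps)
    qed
  qed
qed (use assms in simp)

lemma bloch_norm_rscale:
  assumes f: "f \<in> bloch"
  shows "bloch_norm (fun_rscale f a) = bloch_norm f * norm a"
proof -
  have "(SUP q\<in>unit_ball. bloch_density (fun_rscale f a) q) = (SUP q\<in>unit_ball. bloch_density f q * norm a)"
    using bloch_density_rscale[OF bloch_slice_regular[OF f]] by (intro SUP_cong) simp_all
  also have "\<dots> = (SUP q\<in>unit_ball. bloch_density f q) * norm a"
    using f by (intro SUP_mult_right_real) (auto simp: mem_bloch_iff)
  finally show ?thesis
    by (simp add: bloch_norm_eq fun_rscale_def norm_mult distrib_right)
qed

lemma slice_bloch_norm_add:
  assumes i: "i \<in> imag_unit_sphere" and f: "f \<in> bloch" and g: "g \<in> bloch"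
  shows "slice_bloch_norm i (f + g) \<le> slice_bloch_norm i f + slice_bloch_norm i g"
proof -
  have bdd: "bdd_above (bloch_density h ` slice_ball i)" if "h \<in> bloch" for h
    using that by (simp add: mem_slice_bloch_iff[OF i] flip: slice_bloch_eq_bloch[OF i])
  have "bloch_density (f + g) q \<le> (SUP q\<in>slice_ball i. bloch_density f q) + (SUP q\<in>slice_ball i. bloch_density g q)"
    if "q \<in> slice_ball i" for q
    using bloch_density_add_le[OF bloch_slice_regular[OF f] bloch_slice_regular[OF g]] that
      slice_ball_subset[of i] cSUP_upper[OF that bdd[OF f]] cSUP_upper[OF that bdd[OF g]]
    by fastforce
  then have "(SUP q\<in>slice_ball i. bloch_density (f + g) q)
      \<le> (SUP q\<in>slice_ball i. bloch_density f q) + (SUP q\<in>slice_ball i. bloch_density g q)"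
    using zero_in_slice_ball[OF i] by (intro cSUP_least) auto
  then show ?thesis
    using norm_triangle_ineq[of "f 0" "g 0"] by (simp add: slice_bloch_norm_eq[OF i])
qed

lemma slice_bloch_norm_rscale:
  assumes i: "i \<in> imag_unit_sphere" and f: "f \<in> bloch"
  shows "slice_bloch_norm i (fun_rscale f a) = slice_bloch_norm i f * norm a"
proof -
  have "(SUP q\<in>slice_ball i. bloch_density (fun_rscale f a) q) = (SUP q\<in>slice_ball i. bloch_density f q * norm a)"
    using bloch_density_rscale[OF bloch_slice_regular[OF f]] slice_ball_subset[of i]
    by (intro SUP_cong) auto
  also have "\<dots> = (SUP q\<in>slice_ball i. bloch_density f q) * norm a"
    using f zero_in_slice_ball[OF i]
    by (intro SUP_mult_right_real) (auto simp: mem_slice_bloch_iff[OF i] simp flip: slice_bloch_eq_bloch[OF i])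
  finally show ?thesis
    by (simp add: slice_bloch_norm_eq[OF i] fun_rscale_def norm_mult distrib_right)
qed

text \<open>The bound integrates \<open>\<partial>f/\<partial>x\<^sub>0\<close> along the segment from \<open>0\<close> to \<open>q\<close>, which stays in one slice.\<close>

lemma bloch_pointwise_bound:
  assumes f: "f \<in> bloch" and q: "q \<in> unit_ball"
  shows "(1 - (norm q)\<^sup>2) * norm (f q) \<le> bloch_norm f"
proof -
  obtain I z where I: "I \<in> imag_unit_sphere" and qz: "q = slice_point I z"
    by (rule quat_slice_decomposition)
  with q have z: "cmod z < 1"
    by simp
  define S where "S = bloch_norm f - norm (f 0)"
  define w where "w = 1 - (cmod z)\<^sup>2"
  have w: "0 < w" "w \<le> 1"
    using one_minus_norm_squared_pos[OF q] I by (simp_all add: w_def qz)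
  have S: "bloch_density f p \<le> S" if "p \<in> unit_ball" for p
    using bloch_norm_upper[OF f that] by (simp add: S_def)
  have "0 \<le> S"
    using S[OF q] bloch_density_nonneg[OF q, of f] by linarith
  \<comment> \<open>On the closed disc of radius \<open>cmod z\<close> the weight is at least
    \<open>w\<close>, so the slice derivative is bounded there by \<open>S / w\<close>.\<close>
  have "norm (f (slice_point I z) - f (slice_point I 0)) \<le> S / w * norm (z - 0)"
  proof (rule differentiable_bound)
    fix u :: complex
    assume u: "u \<in> cball 0 (cmod z)"
    let ?c = "partial_x0 f (slice_point I u)"
    have u1: "cmod u < 1" "cmod u \<le> cmod z"
      using u z by simp_all
    show "((\<lambda>z. f (slice_point I z)) has_derivative (\<lambda>h. slice_point I h * ?c)) (at u within cball 0 (cmod z))"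
      using slice_regular_has_slice_derivative[OF bloch_slice_regular[OF f] I u1(1)]
      unfolding has_slice_derivative_def by (rule has_derivative_at_withinI)
    have "w * norm ?c \<le> (1 - (cmod u)\<^sup>2) * norm ?c"
      using u1(2) by (intro mult_right_mono) (simp_all add: w_def power_mono)
    also have "\<dots> \<le> S"
      using S[of "slice_point I u"] I u1(1) by (simp add: bloch_density_def)
    finally have "norm ?c \<le> S / w"
      using w by (simp add: field_simps)
    then have "norm (slice_point I h * ?c) \<le> S / w * norm h" for h
      using I mult_left_mono[of "norm ?c" "S / w" "norm h"]
      by (simp only: norm_mult norm_slice_point mult.commute[of "S / w"] norm_ge_zero)
    then show "onorm (\<lambda>h. slice_point I h * ?c) \<le> S / w"
      by (rule onorm_le)
  qed simp_all
  then have "norm (f q - f 0) \<le> S / w * cmod z"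
    by (simp add: qz)
  also have "\<dots> \<le> S / w"
    using z w \<open>0 \<le> S\<close> by (intro mult_left_le) simp_all
  finally have "norm (f q) \<le> norm (f 0) + S / w"
    using norm_triangle_ineq[of "f 0" "f q - f 0"] by simp
  \<comment> \<open>Multiplying back by \<open>w\<close>, where \<open>w \<le> 1\<close>, leaves
    \<open>norm (f 0) + S\<close>, which is \<open>bloch_norm f\<close>.\<close>
  then have "w * norm (f q) \<le> w * (norm (f 0) + S / w)"
    using w by (intro mult_left_mono) simp_all
  also have "\<dots> = w * norm (f 0) + S"
    using w by (simp add: distrib_left)
  also have "\<dots> \<le> norm (f 0) + S"
    using mult_right_mono[OF w(2) norm_ge_zero[of "f 0"]] by simp
  finally show ?thesis
    using I by (simp add: w_def S_def qz)
qed

section \<open>Limits of slice regular functions and completeness\<close>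

lemma slice_mix_diff: "slice_mix I J (\<lambda>z. g z - h z) z = slice_mix I J g z - slice_mix I J h z"
  by (simp add: slice_mix_def right_diff_distrib scaleR_right_diff_distrib scaleR_right_distrib)

lemma slice_mix_mult_right: "slice_mix I J (\<lambda>z. h z * c) z = slice_mix I J h z * c"
  by (simp add: slice_mix_def distrib_right flip: mult.assoc)

lemma slice_mix_const: "slice_mix I J (\<lambda>_. c) z = c"
  using slice_mix_of_real[of I J "\<lambda>_. c" 0] by (simp add: slice_mix_def)

text \<open>The identity map of the quaternions obeys the representation formula. Together with
  constants and right multiples, this passes the formula on to first order remainders at real
  points.\<close>

lemma slice_mix_slice_point:
  assumes I: "I \<in> imag_unit_sphere" and J: "J \<in> imag_unit_sphere"
  shows "slice_mix I J (slice_point I) z = slice_point J z"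
proof -
  define x y where "x = Re z" and "y = Im z"
  have "(1 - J * I) * (x *\<^sub>R 1 + y *\<^sub>R I) + (1 + J * I) * (x *\<^sub>R 1 - y *\<^sub>R I)
      = 2 *\<^sub>R (x *\<^sub>R 1 + y *\<^sub>R J)"
    by (simp add: left_diff_distrib distrib_right distrib_left right_diff_distrib mult.assoc
        imag_unit_sphere_square[OF I] scaleR_2) (simp add: algebra_simps)
  moreover have "slice_point K z = x *\<^sub>R 1 + y *\<^sub>R K"
    "slice_point K (cnj z) = x *\<^sub>R 1 - y *\<^sub>R K" for K
    by (simp_all add: slice_point_def of_real_def x_def y_def)
  ultimately show ?thesis
    by (simp add: slice_mix_def)
qed

lemma slice_mix_tendsto:
  assumes "((\<lambda>n. h n z) \<longlongrightarrow> l z) F" "((\<lambda>n. h n (cnj z)) \<longlongrightarrow> l (cnj z)) F"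
  shows "((\<lambda>n. slice_mix I J (h n) z) \<longlongrightarrow> slice_mix I J l z) F"
  unfolding slice_mix_def by (intro tendsto_intros assms)

text \<open>At a real point \<open>x\<close> the derivative is \<open>p \<mapsto> p * d x\<close>: the first order remainder again satisfies
  the representation formula, so it is controlled by its values on the slice of \<open>I\<close>.\<close>

lemma slice_extension_differentiable_real:
  assumes I: "I \<in> imag_unit_sphere"
    and rep: "\<And>J z. J \<in> imag_unit_sphere \<Longrightarrow> cmod z < 1 \<Longrightarrow>
      f (slice_point J z) = slice_mix I J (\<lambda>z. f (slice_point I z)) z"
    and der: "has_slice_derivative I (\<lambda>z. f (slice_point I z)) d (of_real x)"
    and x: "\<bar>x\<bar> < 1"
  shows "f differentiable (at (of_real x))"
proof -
  define R where "R p = f p - f (of_real x) - (p - of_real x) * d" for p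
  have rem: "f (slice_point I y) - f (slice_point I (of_real x)) - slice_point I (y - of_real x) * d
      = R (slice_point I y)" for y
    by (simp add: R_def slice_point_diff)
  have R_rep: "R (slice_point J z) = slice_mix I J (\<lambda>z. R (slice_point I z)) z"
    if "J \<in> imag_unit_sphere" "cmod z < 1" for J z
    using that
    by (simp add: R_def slice_mix_diff slice_mix_mult_right slice_mix_const slice_mix_slice_point I
        flip: rep)
  have "(f has_derivative (\<lambda>p. p * d)) (at (of_real x))"
    unfolding has_derivative_at_alt
  proof (intro conjI allI impI)
    show "bounded_linear (\<lambda>p. p * d)"
      by (rule bounded_linear_mult_left)
    fix e :: real assume "e > 0"
    \<comment> \<open>Halved because the remainders at \<open>z\<close> and \<open>cnj z\<close>
      will be added.\<close>
    then have "e / 2 > 0" by simp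
    with der obtain \<delta> where \<delta>: "\<delta> > 0"
      "\<And>y. cmod (y - of_real x) < \<delta> \<Longrightarrow> norm (R (slice_point I y)) \<le> e / 2 * cmod (y - of_real x)"
      unfolding has_slice_derivative_def has_derivative_at_alt rem by blast
    show "\<exists>\<delta>>0. \<forall>p. norm (p - of_real x) < \<delta> \<longrightarrow>
        norm (f p - f (of_real x) - (p - of_real x) * d) \<le> e * norm (p - of_real x)"
    proof (intro exI conjI allI impI)
      \<comment> \<open>The second entry keeps \<open>p\<close> in the unit ball, where
        \<open>rep\<close> is available.\<close>
      show "min \<delta> (1 - \<bar>x\<bar>) > 0"
        using \<delta> x by simp
      fix p :: quat
      assume p: "norm (p - of_real x) < min \<delta> (1 - \<bar>x\<bar>)"
      obtain J z where J: "J \<in> imag_unit_sphere" and pz: "p = slice_point J z"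
        by (rule quat_slice_decomposition)
      have "p - of_real x = slice_point J (z - of_real x)"
        by (simp add: pz slice_point_diff)
      then have n: "norm (p - of_real x) = cmod (z - of_real x)"
        using J by simp
      \<comment> \<open>Conjugation fixes the real centre, so both points of the slice are equally
        far from it.\<close>
      have nc: "cmod (cnj z - of_real x) = cmod (z - of_real x)"
        by (metis complex_cnj_complex_of_real complex_cnj_diff complex_mod_cnj)
      have "cmod z < 1"
        using p n norm_triangle_ineq[of "of_real x" "z - of_real x"] by simp
      then have "norm (R p) \<le> norm (R (slice_point I z)) + norm (R (slice_point I (cnj z)))"
        unfolding pz by (subst R_rep[OF J]) (auto intro: norm_slice_mix_le[OF I J, THEN order_trans])
      also have "\<dots> \<le> e / 2 * cmod (z - of_real x) + e / 2 * cmod (cnj z - of_real x)"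
        using p n nc by (intro add_mono \<delta>) simp_all
      finally show "norm (f p - f (of_real x) - (p - of_real x) * d) \<le> e * norm (p - of_real x)"
        using n nc by (simp add: R_def)
    qed
  qed
  then show ?thesis
    by (rule differentiableI)
qed

text \<open>Near a nonreal point, \<open>J p\<close> and \<open>Z p\<close> are differentiable in
  \<open>p\<close>, and \<open>rep\<close> writes \<open>f\<close> through them; real points, where
  \<open>norm (V p)\<close> has a kink, go to the remainder estimate.\<close>

lemma slice_extension_differentiable_on:
  assumes I: "I \<in> imag_unit_sphere"
    and rep: "\<And>J z. J \<in> imag_unit_sphere \<Longrightarrow> cmod z < 1 \<Longrightarrow>
      f (slice_point J z) = slice_mix I J (\<lambda>z. f (slice_point I z)) z"
    and der: "\<And>z. cmod z < 1 \<Longrightarrow> has_slice_derivative I (\<lambda>z. f (slice_point I z)) (d z) z"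
  shows "f differentiable_on unit_ball"
proof (intro differentiable_at_imp_differentiable_on ballI)
  fix q assume q: "q \<in> unit_ball"
  define V where "V p = p - (p \<bullet> 1) *\<^sub>R 1" for p :: quat
  show "f differentiable (at q)"
  proof (cases "V q = 0")
    case True
    then have qx: "q = of_real (q \<bullet> 1)"
      by (simp add: V_def of_real_def)
    with q have "\<bar>q \<bullet> 1\<bar> < 1"
      by (metis norm_of_real mem_ball_0 unit_ball_def)
    with slice_extension_differentiable_real[OF I rep der, of "q \<bullet> 1"] qx show ?thesis
      by simp
  next
    case False
    define J where "J p = inverse (norm (V p)) *\<^sub>R V p" for p
    define Z where "Z p = (p \<bullet> 1) *\<^sub>R 1 + norm (V p) *\<^sub>R \<i>" for p
    let ?h = "\<lambda>z. f (slice_point I z)"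
    have J: "J p \<in> imag_unit_sphere" and Z: "p = slice_point (J p) (Z p)" if "V p \<noteq> 0" for p
    proof -
      have "qx0 (V p) = 0"
        by (simp add: V_def inner_quat_def)
      with that show "J p \<in> imag_unit_sphere"
        by (simp add: imag_unit_sphere_def J_def)
      have "slice_point (J p) (Z p) = (p \<bullet> 1) *\<^sub>R 1 + V p"
        using that by (simp add: slice_point_def Z_def J_def of_real_def)
      then show "p = slice_point (J p) (Z p)"
        by (simp add: V_def)
    qed
    have V_diff: "V differentiable (at q)"
      unfolding V_def [abs_def]
      by (intro bounded_linear_imp_differentiable bounded_linear_sub bounded_linear_ident
          bounded_linear_scaleR_const bounded_linear_inner_left)
    have norm_V: "(\<lambda>p. norm (V p)) differentiable (at q)"
      using False by (intro differentiable_compose[of norm V] V_diff differentiable_norm_at)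
    have inner_diff: "(\<lambda>p::quat. p \<bullet> 1) differentiable (at q)"
      by (intro bounded_linear_imp_differentiable bounded_linear_inner_left)
    have J_diff: "J differentiable (at q)"
      unfolding J_def [abs_def] using False
      by (intro differentiable_scaleR differentiable_inverse norm_V V_diff) simp
    have Z_diff: "Z differentiable (at q)"
      unfolding Z_def [abs_def]
      by (intro differentiable_add differentiable_scaleR norm_V inner_diff differentiable_const)
    have cnj_Z: "(\<lambda>p. cnj (Z p)) differentiable (at q)"
      using bounded_linear_imp_differentiable[OF bounded_linear_cnj] Z_diff
      by (rule differentiable_compose)
    have norm_Z: "cmod (Z p) < 1" if "p \<in> unit_ball" "V p \<noteq> 0" for p
      using that Z[OF that(2)] J[OF that(2)] slice_point_in_unit_ball_iff by metis
    have h_diff: "?h differentiable (at z)" if "cmod z < 1" for z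
      using der[OF that] unfolding has_slice_derivative_def by (rule differentiableI)
    have hZ: "(\<lambda>p. ?h (Z p)) differentiable (at q)"
      using norm_Z[OF q False] by (intro differentiable_compose[OF h_diff Z_diff])
    have hcZ: "(\<lambda>p. ?h (cnj (Z p))) differentiable (at q)"
      using norm_Z[OF q False] by (intro differentiable_compose[OF h_diff cnj_Z]) simp
    have "(\<lambda>p. slice_mix I (J p) ?h (Z p)) differentiable (at q)"
      unfolding slice_mix_def
      by (intro differentiable_scaleR differentiable_add differentiable_mult differentiable_diff
          differentiable_const J_diff hZ hcZ)
    then obtain D where D: "((\<lambda>p. slice_mix I (J p) ?h (Z p)) has_derivative D) (at q)"
      unfolding differentiable_def by blast
    \<comment> \<open>The composite represents \<open>f\<close> only inside the ball and off the
      real axis, which is an open neighbourhood of \<open>q\<close>.\<close>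
    have "open (unit_ball \<inter> {p. V p \<noteq> 0})"
      unfolding V_def by (intro open_Int open_unit_ball open_Collect_neq continuous_intros)
    with D have "(f has_derivative D) (at q)"
    proof (rule has_derivative_transform_within_open)
      show "q \<in> unit_ball \<inter> {p. V p \<noteq> 0}"
        using q False by simp
      fix p assume "p \<in> unit_ball \<inter> {p. V p \<noteq> 0}"
      then have p: "p \<in> unit_ball" "V p \<noteq> 0" by simp_all
      show "slice_mix I (J p) ?h (Z p) = f p"
        using rep[OF J[OF p(2)] norm_Z[OF p]] Z[OF p(2)] by simp
    qed
    then show ?thesis
      by (rule differentiableI)
  qed
qed

text \<open>Since \<open>slice_point I\<close> preserves norms, uniform convergence of the
  coefficients is uniform convergence of the differentials in operator norm.\<close>

lemma slice_derivative_limit: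
  assumes I: "I \<in> imag_unit_sphere" and r: "0 < r"
    and der: "\<And>n z. z \<in> ball 0 r \<Longrightarrow> has_slice_derivative I (h n) (c n z) z"
    and unif: "uniform_limit (ball 0 r) c d sequentially"
    and lim: "\<And>z. z \<in> ball 0 r \<Longrightarrow> (\<lambda>n. h n z) \<longlonglongrightarrow> l z"
    and z: "z \<in> ball 0 r"
  shows "has_slice_derivative I l (d z) z"
proof -
  have "\<exists>g. \<forall>x\<in>ball 0 r. (\<lambda>n. h n x) \<longlonglongrightarrow> g x
      \<and> (g has_derivative (\<lambda>w. slice_point I w * d x)) (at x within ball 0 r)"
  proof (rule has_derivative_sequence)
    show "(h n has_derivative (\<lambda>w. slice_point I w * c n x)) (at x within ball 0 r)"
      if "x \<in> ball 0 r" for n x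
      using der[OF that] unfolding has_slice_derivative_def by (rule has_derivative_at_withinI)
    show "\<forall>\<^sub>F n in sequentially. \<forall>x\<in>ball 0 r. \<forall>w.
        norm (slice_point I w * c n x - slice_point I w * d x) \<le> e * norm w" if "e > 0" for e
      using uniform_limitD[OF unif that]
    proof eventually_elim
      case (elim n)
      show ?case
      proof (intro ballI allI)
        fix x :: complex and w assume "x \<in> ball 0 r"
        then have "norm (c n x - d x) \<le> e"
          using elim by (simp add: dist_norm less_imp_le)
        then show "norm (slice_point I w * c n x - slice_point I w * d x) \<le> e * norm w"
          using mult_left_mono[of _ e "norm w"] I
          by (simp add: norm_mult mult.commute[of e] flip: right_diff_distrib)
      qed
    qed
    show "(\<lambda>n. h n 0) \<longlonglongrightarrow> l 0" "(0::complex) \<in> ball 0 r"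
      using r by (simp_all add: lim)
  qed simp
  then obtain g where g: "\<And>x. x \<in> ball 0 r \<Longrightarrow> (\<lambda>n. h n x) \<longlonglongrightarrow> g x"
      "\<And>x. x \<in> ball 0 r \<Longrightarrow> (g has_derivative (\<lambda>w. slice_point I w * d x)) (at x within ball 0 r)"
    by blast
  have "(g has_derivative (\<lambda>w. slice_point I w * d z)) (at z)"
    using g(2)[OF z] at_within_open[OF z open_ball] by simp
  \<comment> \<open>The theorem on sequences of derivatives supplies its own limit \<open>g\<close>;
    uniqueness of pointwise limits identifies it with \<open>l\<close> on the disc.\<close>
  then have "(l has_derivative (\<lambda>w. slice_point I w * d z)) (at z)"
    by (rule has_derivative_transform_within_open[OF _ open_ball z])
       (use LIMSEQ_unique[OF g(1) lim] in blast)
  then show ?thesis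
    unfolding has_slice_derivative_def .
qed

lemma slice_regular_limit:
  assumes X: "\<And>n. slice_regular (X n)"
    and lim: "\<And>q. q \<in> unit_ball \<Longrightarrow> (\<lambda>n. X n q) \<longlonglongrightarrow> l q"
    and unif: "\<And>r. r < 1 \<Longrightarrow> uniform_limit (ball 0 r) (\<lambda>n. partial_x0 (X n)) g sequentially"
  shows "slice_regular l" "q \<in> unit_ball \<Longrightarrow> partial_x0 l q = g q"
proof -
  have der: "has_slice_derivative I (\<lambda>z. l (slice_point I z)) (g (slice_point I z)) z"
    if I: "I \<in> imag_unit_sphere" and z: "cmod z < 1" for I z
  proof -
    obtain r where r: "cmod z < r" "r < 1"
      using dense[OF z] by blast
    show ?thesis
    proof (rule slice_derivative_limit[OF I])
      show "0 < r" "z \<in> ball 0 r"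
        using r by (simp_all add: order.strict_trans1[OF norm_ge_zero])
      show "has_slice_derivative I (\<lambda>z. X n (slice_point I z)) (partial_x0 (X n) (slice_point I z)) z"
        if "z \<in> ball 0 r" for n z
        using that r(2) by (intro slice_regular_has_slice_derivative X I) simp
      show "(\<lambda>n. X n (slice_point I z)) \<longlonglongrightarrow> l (slice_point I z)" if "z \<in> ball 0 r" for z
        using that r(2) I by (intro lim) simp
      show "uniform_limit (ball 0 r) (\<lambda>n z. partial_x0 (X n) (slice_point I z)) (\<lambda>z. g (slice_point I z)) sequentially"
        using unif[OF r(2)] by (rule uniform_limit_compose') (use I in simp)
    qed
  qed
  have rep: "l (slice_point J z) = slice_mix I J (\<lambda>z. l (slice_point I z)) z"
    if I: "I \<in> imag_unit_sphere" and J: "J \<in> imag_unit_sphere" and z: "cmod z < 1" for I J z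
  proof (rule LIMSEQ_unique)
    show "(\<lambda>n. X n (slice_point J z)) \<longlonglongrightarrow> l (slice_point J z)"
      using J z by (intro lim) simp
    show "(\<lambda>n. X n (slice_point J z)) \<longlonglongrightarrow> slice_mix I J (\<lambda>z. l (slice_point I z)) z"
      unfolding representation_formula[OF X I J z]
      using I z by (intro slice_mix_tendsto lim) simp_all
  qed
  \<comment> \<open>A single slice determines the extension, so an arbitrary unit suffices.\<close>
  obtain I where I: "I \<in> imag_unit_sphere"
    using quat_slice_decomposition[of 0] by blast
  show l: "slice_regular l"
    using slice_extension_differentiable_on[OF I rep[OF I] der[OF I]] der
    by (intro slice_regularI) blast+
  show "partial_x0 l q = g q" if q: "q \<in> unit_ball"
  proof -
    obtain I z where I: "I \<in> imag_unit_sphere" and qz: "q = slice_point I z"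
      by (rule quat_slice_decomposition)
    with q have "cmod z < 1" by simp
    from has_slice_derivative_unique[OF slice_regular_has_slice_derivative[OF l I this] der[OF I this]]
    show ?thesis
      by (simp add: qz)
  qed
qed

section \<open>Completeness of the Bloch space\<close>

lemma bloch_complete:
  assumes X: "\<And>n. X n \<in> bloch"
    and Cauchy: "\<And>e. e > 0 \<Longrightarrow> \<exists>M. \<forall>m\<ge>M. \<forall>n\<ge>M. bloch_norm (X m - X n) < e"
  shows "\<exists>l\<in>bloch. (\<lambda>n. bloch_norm (X n - l)) \<longlonglongrightarrow> 0"
proof -
  have reg: "slice_regular (X n)" for n
    using X by (rule bloch_slice_regular)
  have wd: "(1 - (norm q)\<^sup>2) * norm (partial_x0 (X m) q - partial_x0 (X n) q) \<le> bloch_norm (X m - X n)"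
    if "q \<in> unit_ball" for q m n
    using bloch_norm_upper[OF bloch_diff[OF X X] that, of m n] norm_ge_zero[of "(X m - X n) 0"]
    unfolding bloch_density_def partial_x0_diff[OF reg reg that] by linarith
  \<comment> \<open>Serves values and derivatives alike: the weight \<open>w\<close> may depend on
    the point but not on the index.\<close>
  have CauchyI': "Cauchy a"
    if "0 < w" and le: "\<And>m n. w * norm (a m - a n) \<le> bloch_norm (X m - X n)" for w and a :: "nat \<Rightarrow> quat"
  proof (rule CauchyI)
    fix e :: real assume "0 < e"
    then obtain M where M: "\<forall>m\<ge>M. \<forall>n\<ge>M. bloch_norm (X m - X n) < w * e"
      using Cauchy[of "w * e"] \<open>0 < w\<close> by auto
    show "\<exists>M. \<forall>m\<ge>M. \<forall>n\<ge>M. norm (a m - a n) < e"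
    proof (intro exI allI impI)
      fix m n assume "m \<ge> M" "n \<ge> M"
      with M le[of m n] have "w * norm (a m - a n) < w * e"
        by (meson order.strict_trans1)
      with \<open>0 < w\<close> show "norm (a m - a n) < e"
        by simp
    qed
  qed
  define g where "g q = lim (\<lambda>n. partial_x0 (X n) q)" for q
  define l where "l q = lim (\<lambda>n. X n q)" for q
  have g: "(\<lambda>n. partial_x0 (X n) q) \<longlonglongrightarrow> g q" if q: "q \<in> unit_ball" for q
    using CauchyI'[OF one_minus_norm_squared_pos[OF q] wd[OF q]]
    unfolding g_def by (simp add: Cauchy_convergent_iff convergent_LIMSEQ_iff)
  have l: "(\<lambda>n. X n q) \<longlonglongrightarrow> l q" if q: "q \<in> unit_ball" for q
    using CauchyI'[OF one_minus_norm_squared_pos[OF q], of "\<lambda>n. X n q"]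
      bloch_pointwise_bound[OF bloch_diff[OF X X] q]
    unfolding l_def by (simp add: Cauchy_convergent_iff convergent_LIMSEQ_iff)
  have l0: "l q = 0" if q: "q \<notin> unit_ball" for q
    unfolding l_def using bloch_outside[OF X q] by simp
  \<comment> \<open>Fix \<open>n\<close> and let \<open>m\<close> tend to infinity in the Cauchy
    estimate; \<open>M\<close> comes from the norm and thus works for all points at once.\<close>
  have tail: "\<exists>M. \<forall>n\<ge>M. \<forall>q\<in>unit_ball. (1 - (norm q)\<^sup>2) * norm (partial_x0 (X n) q - g q) \<le> e"
    if e: "e > 0" for e
  proof -
    obtain M where M: "\<forall>m\<ge>M. \<forall>n\<ge>M. bloch_norm (X m - X n) < e"
      using Cauchy[OF e] by blast
    show ?thesis
    proof (intro exI allI impI ballI)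
      fix n q assume n: "n \<ge> M" and q: "q \<in> unit_ball"
      have "(\<lambda>m. (1 - (norm q)\<^sup>2) * norm (partial_x0 (X n) q - partial_x0 (X m) q))
          \<longlonglongrightarrow> (1 - (norm q)\<^sup>2) * norm (partial_x0 (X n) q - g q)"
        by (intro tendsto_intros g q)
      moreover have "(1 - (norm q)\<^sup>2) * norm (partial_x0 (X n) q - partial_x0 (X m) q) \<le> e" if "m \<ge> M" for m
        using wd[OF q, of n m] M n that by (meson less_imp_le order_trans)
      ultimately show "(1 - (norm q)\<^sup>2) * norm (partial_x0 (X n) q - g q) \<le> e"
        by (intro LIMSEQ_le_const2) auto
    qed
  qed
  have unif: "uniform_limit (ball 0 r) (\<lambda>n. partial_x0 (X n)) g sequentially" if "r < 1" for r
  \<comment> \<open>For nonpositive \<open>r\<close> the ball is empty; \<open>1 - r\<^sup>2\<close>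
    need not be positive then.\<close>
  proof (cases "r \<le> 0")
    case False
    \<comment> \<open>A lower bound for the weight on \<open>ball 0 r\<close>. It degenerates as
      \<open>r\<close> approaches 1, so convergence is only locally uniform.\<close>
    define w where "w = 1 - r\<^sup>2"
    have w: "w > 0"
      using that False by (simp add: w_def abs_square_less_1)
    show ?thesis
    proof (rule uniform_limitI)
      fix e :: real assume "e > 0"
      with w obtain M where M: "\<forall>n\<ge>M. \<forall>q\<in>unit_ball. (1 - (norm q)\<^sup>2) * norm (partial_x0 (X n) q - g q) \<le> w * (e / 2)"
        using tail[of "w * (e / 2)"] by auto
      have "dist (partial_x0 (X n) q) (g q) < e" if "n \<ge> M" and q: "q \<in> ball 0 r" for n q
      proof -
        have "(norm q)\<^sup>2 \<le> r\<^sup>2"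
          using q by (intro power_mono) simp_all
        then have "w * norm (partial_x0 (X n) q - g q) \<le> (1 - (norm q)\<^sup>2) * norm (partial_x0 (X n) q - g q)"
          by (intro mult_right_mono) (simp_all add: w_def)
        also have "\<dots> \<le> w * (e / 2)"
          using M that \<open>r < 1\<close> by (simp add: unit_ball_def)
        finally show ?thesis
          using w \<open>e > 0\<close> by (simp add: dist_norm)
      qed
      then show "\<forall>\<^sub>F n in sequentially. \<forall>q\<in>ball 0 r. dist (partial_x0 (X n) q) (g q) < e"
        unfolding eventually_sequentially by blast
    qed
  qed (simp add: uniform_limit_iff ball_empty)
  have lreg: "slice_regular l" and lg: "\<And>q. q \<in> unit_ball \<Longrightarrow> partial_x0 l q = g q"
    using slice_regular_limit[OF reg l unif] by simp_all
  have density: "bloch_density (X n - l) q = (1 - (norm q)\<^sup>2) * norm (partial_x0 (X n) q - g q)"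
    if "q \<in> unit_ball" for n q
    by (simp add: bloch_density_def partial_x0_diff[OF reg lreg that] lg[OF that])
  have "l \<in> bloch"
  proof -
    obtain M where M: "\<forall>n\<ge>M. \<forall>q\<in>unit_ball. (1 - (norm q)\<^sup>2) * norm (partial_x0 (X n) q - g q) \<le> 1"
      using tail[of 1] by auto
    \<comment> \<open>A single tail estimate puts this difference in the space; subtracting it from
      \<open>X M\<close> recovers \<open>l\<close>.\<close>
    have "X M - l \<in> bloch"
    proof (rule blochI)
      show "X M - l \<in> slice_regular_functions"
        using slice_regular_diff[OF reg lreg] bloch_outside[OF X] l0
        by (simp add: slice_regular_functions_def)
      show "bloch_density (X M - l) q \<le> 1" if "q \<in> unit_ball" for q
        using M that by (simp add: density)
    qed
    from bloch_diff[OF X[of M] this] show ?thesis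
      by simp
  qed
  moreover have "(\<lambda>n. bloch_norm (X n - l)) \<longlonglongrightarrow> 0"
  proof (rule LIMSEQ_I)
    fix e :: real assume "e > 0"
    \<comment> \<open>Thirds leave room for a strict inequality: the value at 0 and the supremum
      together give at most \<open>2 * e / 3\<close>.\<close>
    then obtain M where M: "\<forall>n\<ge>M. \<forall>q\<in>unit_ball. (1 - (norm q)\<^sup>2) * norm (partial_x0 (X n) q - g q) \<le> e / 3"
      using tail[of "e / 3"] by auto
    obtain M' where M': "\<forall>n\<ge>M'. norm (X n 0 - l 0) < e / 3"
      using LIMSEQ_D[OF l[OF zero_in_unit_ball], of "e / 3"] \<open>e > 0\<close> by auto
    show "\<exists>M. \<forall>n\<ge>M. norm (bloch_norm (X n - l) - 0) < e"
    proof (intro exI allI impI)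
      fix n assume n: "n \<ge> max M M'"
      have "bloch_norm (X n - l) \<le> e / 3 + e / 3"
        using M M' n by (intro bloch_norm_least add_mono) (simp_all add: density less_imp_le)
      moreover have "0 \<le> bloch_norm (X n - l)"
        using bloch_pointwise_bound[OF bloch_diff[OF X \<open>l \<in> bloch\<close>] zero_in_unit_ball, of n]
        by (simp add: order_trans[OF norm_ge_zero])
      ultimately show "norm (bloch_norm (X n - l) - 0) < e"
        using \<open>e > 0\<close> by simp
    qed
  qed
  ultimately show ?thesis
    by blast
qed

section \<open>Definiteness and the space axioms\<close>

lemma bloch_zero: "0 \<in> bloch" and bloch_norm_zero: "bloch_norm 0 = 0"
  and slice_bloch_norm_zero: "i \<in> imag_unit_sphere \<Longrightarrow> slice_bloch_norm i 0 = 0"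
proof -
  have "((\<lambda>_. 0) has_derivative (\<lambda>_. 0)) (at q)" for q :: quat
    by simp
  from partial_x0_eq[OF this] have p: "partial_x0 0 q = 0" for q
    by (simp add: zero_fun_def)
  then have d: "bloch_density 0 q = 0" for q
    by (simp add: bloch_density_def)
  have "slice_regular 0"
    by (rule slice_regularI) (auto simp: zero_fun_def has_slice_derivative_def intro!: exI[of _ 0])
  then show "0 \<in> bloch"
    by (intro blochI[where B = 0]) (simp_all add: slice_regular_functions_def d)
  show "bloch_norm 0 = 0"
    by (simp add: bloch_norm_eq d)
  show "slice_bloch_norm i 0 = 0" if "i \<in> imag_unit_sphere"
  proof -
    have "slice_ball i \<noteq> {}"
      using zero_in_slice_ball[OF that] by blast
    then show ?thesis
      by (simp add: slice_bloch_norm_eq[OF that] d)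
  qed
qed

text \<open>The pointwise bound kills \<open>f\<close> inside the ball and the extension by zero
  outside. With \<open>\<le>\<close> in the hypothesis it also serves the slice norm, whose
  vanishing yields \<open>bloch_norm f \<le> 2 * 0\<close>.\<close>

lemma bloch_norm_le_0D:
  assumes f: "f \<in> bloch" and "bloch_norm f \<le> 0"
  shows "f = 0"
proof
  fix q
  show "f q = 0 q"
  proof (cases "q \<in> unit_ball")
    case True
    have "(1 - (norm q)\<^sup>2) * norm (f q) \<le> 0"
      using bloch_pointwise_bound[OF f True] assms(2) by linarith
    then show ?thesis
      using one_minus_norm_squared_pos[OF True] by (simp add: mult_le_0_iff)
  qed (simp add: bloch_outside[OF f])
qed

lemma quat_right_banach_space_bloch: "quat_right_banach_space bloch fun_rscale bloch_norm"
proof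
  show "bloch_norm f = 0 \<longleftrightarrow> f = 0" if "f \<in> bloch" for f
    using bloch_norm_le_0D[OF that] bloch_norm_zero by auto
  show "\<exists>l\<in>bloch. (\<lambda>n. bloch_norm (X n - l)) \<longlonglongrightarrow> 0"
    if "range X \<subseteq> bloch" "\<forall>e>0. \<exists>M. \<forall>m\<ge>M. \<forall>n\<ge>M. bloch_norm (X m - X n) < e" for X
    using that by (intro bloch_complete) auto
qed (simp_all add: bloch_zero bloch_add bloch_rscale bloch_norm_rscale,
     simp_all add: fun_rscale_def fun_eq_iff distrib_left distrib_right mult.assoc)

lemma quat_right_normed_space_slice_bloch:
  assumes i: "i \<in> imag_unit_sphere"
  shows "quat_right_normed_space (slice_bloch i) fun_rscale (slice_bloch_norm i)"
  unfolding slice_bloch_eq_bloch[OF i]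
proof
  show "slice_bloch_norm i f = 0 \<longleftrightarrow> f = 0" if "f \<in> bloch" for f
    using bloch_norm_le_0D[OF that] bloch_norm_le_slice_bloch_norm[OF i that]
      slice_bloch_norm_zero[OF i] by auto
qed (simp_all add: bloch_zero bloch_add bloch_rscale slice_bloch_norm_add[OF i] slice_bloch_norm_rscale[OF i],
     simp_all add: fun_rscale_def fun_eq_iff distrib_left distrib_right mult.assoc)

theorem proposition2p6:
  fixes i :: quat
  assumes "i \<in> imag_unit_sphere"
  shows "(\<forall>f. f \<in> slice_bloch i \<longleftrightarrow> f \<in> bloch) \<and>
    quat_right_banach_space bloch fun_rscale bloch_norm \<and>
    quat_right_normed_space (slice_bloch i) fun_rscale (slice_bloch_norm i) \<and>
    equivalent_norms_on bloch bloch_norm (slice_bloch_norm i) \<and>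
    (\<forall>f\<in>bloch. slice_bloch_norm i f \<le> bloch_norm f \<and> bloch_norm f \<le> 2 * slice_bloch_norm i f)"
proof -
  have le: "slice_bloch_norm i f \<le> bloch_norm f" "bloch_norm f \<le> 2 * slice_bloch_norm i f"
    if "f \<in> bloch" for f
    using slice_bloch_norm_le_bloch_norm[OF assms that] bloch_norm_le_slice_bloch_norm[OF assms that] .
  \<comment> \<open>The constants 1/2 and 1 are the two-sided estimate solved for the slice
    norm.\<close>
  then have "equivalent_norms_on bloch bloch_norm (slice_bloch_norm i)"
    unfolding equivalent_norms_on_def
    by (intro exI[of _ "1/2"] conjI exI[of _ 1]) (auto simp: field_simps)
  with le show ?thesis
    by (simp add: slice_bloch_eq_bloch[OF assms] quat_right_banach_space_bloch
        quat_right_normed_space_slice_bloch[OF assms, unfolded slice_bloch_eq_bloch[OF assms]])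
qed

end
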